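(* For $p\in[0,1]$ let $\Gamma_{1,3}$ be the percolation Markov decision process on $\mathbb{Z}$ with i.i.d. $\mathrm{Bernoulli}(p)$ payoffs on the vertices and action set $\{1,3\}$. Let $p^*\approx0.26102$ be the only real root of $2X^3-5X^2+5X-1$. (1) For $p\in[0,p^*]$, the 2-myopic strategy $$\sigma^*(00)=+3,\quad\sigma^*(01)=+1,\quad\sigma^*(10)=+1,\quad\sigma^*(11)=+1$$ is optimal for $\Gamma_{1,3}$. (2) For $p\in(p^*,1)$, no myopic strategy is optimal; an optimal strategy is given, for $k\ge0$, by $$\begin{aligned}\sigma^*(00)&=+3,\\ \sigma^*(010^k1)&=+3\ \text{ if } k\equiv0 \text{ or } 1 \pmod 3,\\ \sigma^*(010^k1)&=+1\ \text{ if } k\equiv2\pmod 3,\\ \sigma^*(10^k1)&=+1\ \text{ if } k\equiv0\text{ or }2\pmod 3,\\ \sigma^*(10^k1)&=+3\ \text{ if } k\equiv1\pmod 3.\end{aligned}$$ (3) The uniform value is $$v_\infty(p)=\begin{cases}\dfrac{p(3-3p+p^2)}{1+p-p^2} & \text{if } p\le p^*,\\[2mm] \dfrac{p\left(28-90p+127p^2-98p^3+43p^4-10p^5+p^6\right)}{12-29p+25p^2-2p^3-10p^4+6p^5-p^6} & \text{if } p\ge p^*.\end{cases}$$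
   Context: Percolation Markov decision process on $\mathbb{Z}$ with payoffs on the vertices: $I\subset\mathbb{Z}$ is a non-empty finite action set, and $(g_\omega(z))_{z\in\mathbb{Z}}$ are i.i.d. real random variables (here $\mathrm{Bernoulli}(p)$) on a probability space $(\Omega,\mathscr{F},\mathbb{P})$; taking action $i$ at state $z$ gives payoff $g_\omega(z+i)$ and moves the state to $z+i$. The realization $\omega$ of all payoffs is known in advance to the decision maker. A strategy is a sequence $\sigma=(\sigma_m)_{m\ge1}$ of maps $\sigma_m:\Omega\times\mathbb{Z}\to I$ measurable with respect to the product of the $\sigma$-algebra generated by the payoffs and $\mathcal{P}(\mathbb{Z})$; given initial state $z$, it induces $z_1=z$, $i_m=\sigma_m(\omega,z)$, $z_{m+1}=z_m+i_m$. The $n$-stage payoff is $\gamma_n(z,\sigma)=\frac1n\sum_{m=1}^n g_\omega(z_m+i_m)$ and the $n$-stage value is $v_n(z)=\max_\sigma\gamma_n(z,\sigma)$. The limit value $v_\infty(p)$ is the $\mathbb{P}$-almost sure limit of $v_n(z)$ as $n\to\infty$ (a constant independent of $z$); it is the uniform value if for every $\varepsilon>0$ there is a strategy $\sigma$ such that, $\mathbb{P}$-a.s., $\gamma_n(z,\sigma)\ge v_\infty(p)-\varepsilon$ for all sufficiently large $n$. A strategy is stationary if the action at each stage depends only on $\omega$ and the current state. A stationary strategy is $k$-myopic if the action depends only on the realization of the payoffs at the next $k$ positions to the right of the current position, and myopic if it is $k$-myopic for some $k$. The notation $\sigma(x_1\cdots x_r)=i$ means that action $i$ is played at state $z$ whenever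 $g_\omega(z+j)=x_j$ for $1\le j\le r$; $0^k$ denotes a block of $k$ zeros (empty for $k=0$). In (2), almost surely exactly one of the listed patterns occurs to the right of each state; on the null event where none occurs the action is arbitrary. "Optimal" means 0-optimal: for every initial state $z$, $\gamma_n(z,\sigma)\to v_\infty(p)$ as $n\to\infty$, $\mathbb{P}$-a.s. *)

theory Defs
  imports "HOL-Probability.Probability"
begin

text \<open>
  Percolation Markov decision processes on the integers. Throughout, \<open>M\<close> is the probability
  space, \<open>g z \<omega>\<close> the payoff at vertex \<open>z\<close>, and \<open>I\<close> the action set. Stages are numbered from 0,
  so index \<open>m\<close> below is stage \<open>m + 1\<close> in the usual numbering from 1.
\<close>

definition bernoulli_percolation :: "'w measure \<Rightarrow> (int \<Rightarrow> 'w \<Rightarrow> real) \<Rightarrow> real \<Rightarrow> bool" where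
  "bernoulli_percolation M g p \<longleftrightarrow>
     prob_space M \<and>
     prob_space.indep_vars M (\<lambda>_. borel) g UNIV \<and>
     (\<forall>z. distr M borel (g z) = distr (measure_pmf (bernoulli_pmf p)) borel of_bool)"

definition payoff_algebra :: "'w measure \<Rightarrow> (int \<Rightarrow> 'w \<Rightarrow> real) \<Rightarrow> 'w measure" where
  "payoff_algebra M g =
     sigma (space M) (\<Union>z. {g z -` A \<inter> space M | A. A \<in> sets borel})"

text \<open>
  The integer argument of \<open>\<sigma> m \<omega> z\<close> is the initial state, not the current one;
  measurability into \<open>count_space I\<close> includes that actions belong to \<open>I\<close>.
\<close>

definition strategy ::
  "'w measure \<Rightarrow> (int \<Rightarrow> 'w \<Rightarrow> real) \<Rightarrow> int set \<Rightarrow> (nat \<Rightarrow> 'w \<Rightarrow> int \<Rightarrow> int) \<Rightarrow> bool" where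
  "strategy M g I \<sigma> \<longleftrightarrow>
     (\<forall>m. (\<lambda>(\<omega>, z). \<sigma> m \<omega> z) \<in>
        measurable (payoff_algebra M g \<Otimes>\<^sub>M count_space UNIV) (count_space I))"

primrec state :: "(nat \<Rightarrow> 'w \<Rightarrow> int \<Rightarrow> int) \<Rightarrow> 'w \<Rightarrow> int \<Rightarrow> nat \<Rightarrow> int" where
  "state \<sigma> \<omega> z 0 = z"
| "state \<sigma> \<omega> z (Suc m) = state \<sigma> \<omega> z m + \<sigma> m \<omega> z"

definition avg_payoff ::
  "(int \<Rightarrow> 'w \<Rightarrow> real) \<Rightarrow> (nat \<Rightarrow> 'w \<Rightarrow> int \<Rightarrow> int) \<Rightarrow> nat \<Rightarrow> 'w \<Rightarrow> int \<Rightarrow> real" where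
  "avg_payoff g \<sigma> n \<omega> z =
     (1 / real n) * (\<Sum>m<n. g (state \<sigma> \<omega> z m + \<sigma> m \<omega> z) \<omega>)"

text \<open>
  For finite non-empty \<open>I\<close> and \<open>\<omega> \<in> space M\<close> the set below is finite and non-empty,
  because only the first \<open>n\<close> actions matter; hence \<open>Max\<close> is a genuine maximum.
\<close>

definition stage_value ::
  "'w measure \<Rightarrow> (int \<Rightarrow> 'w \<Rightarrow> real) \<Rightarrow> int set \<Rightarrow> nat \<Rightarrow> 'w \<Rightarrow> int \<Rightarrow> real" where
  "stage_value M g I n \<omega> z = Max {avg_payoff g \<sigma> n \<omega> z | \<sigma>. strategy M g I \<sigma>}"

definition limit_value ::
  "'w measure \<Rightarrow> (int \<Rightarrow> 'w \<Rightarrow> real) \<Rightarrow> int set \<Rightarrow> real \<Rightarrow> bool" where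
  "limit_value M g I v \<longleftrightarrow>
     (\<forall>z. AE \<omega> in M. (\<lambda>n. stage_value M g I n \<omega> z) \<longlonglongrightarrow> v)"

definition uniform_value ::
  "'w measure \<Rightarrow> (int \<Rightarrow> 'w \<Rightarrow> real) \<Rightarrow> int set \<Rightarrow> real \<Rightarrow> bool" where
  "uniform_value M g I v \<longleftrightarrow>
     limit_value M g I v \<and>
     (\<forall>\<epsilon>>0. \<exists>\<sigma>. strategy M g I \<sigma> \<and>
        (\<forall>z. AE \<omega> in M. \<forall>\<^sub>F n in sequentially. avg_payoff g \<sigma> n \<omega> z \<ge> v - \<epsilon>))"

definition optimal ::
  "'w measure \<Rightarrow> (int \<Rightarrow> 'w \<Rightarrow> real) \<Rightarrow> int set \<Rightarrow> (nat \<Rightarrow> 'w \<Rightarrow> int \<Rightarrow> int) \<Rightarrow> bool" where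
  "optimal M g I \<sigma> \<longleftrightarrow>
     strategy M g I \<sigma> \<and>
     (\<exists>v. limit_value M g I v \<and> (\<forall>z. AE \<omega> in M. (\<lambda>n. avg_payoff g \<sigma> n \<omega> z) \<longlonglongrightarrow> v))"

definition stationary ::
  "'w measure \<Rightarrow> (int \<Rightarrow> 'w \<Rightarrow> real) \<Rightarrow> int set \<Rightarrow> (nat \<Rightarrow> 'w \<Rightarrow> int \<Rightarrow> int) \<Rightarrow> bool" where
  "stationary M g I \<sigma> \<longleftrightarrow>
     strategy M g I \<sigma> \<and>
     (\<exists>s. \<forall>\<omega>\<in>space M. \<forall>z m. \<sigma> m \<omega> z = s \<omega> (state \<sigma> \<omega> z m))"

definition window :: "(int \<Rightarrow> 'w \<Rightarrow> real) \<Rightarrow> nat \<Rightarrow> 'w \<Rightarrow> int \<Rightarrow> real list" where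
  "window g k \<omega> z = map (\<lambda>j. g (z + int j) \<omega>) [1..<Suc k]"

definition k_myopic ::
  "'w measure \<Rightarrow> (int \<Rightarrow> 'w \<Rightarrow> real) \<Rightarrow> int set \<Rightarrow> nat \<Rightarrow> (nat \<Rightarrow> 'w \<Rightarrow> int \<Rightarrow> int) \<Rightarrow> bool" where
  "k_myopic M g I k \<sigma> \<longleftrightarrow>
     stationary M g I \<sigma> \<and>
     (\<exists>f. \<forall>\<omega>\<in>space M. \<forall>z m. \<sigma> m \<omega> z = f (window g k \<omega> (state \<sigma> \<omega> z m)))"

definition myopic ::
  "'w measure \<Rightarrow> (int \<Rightarrow> 'w \<Rightarrow> real) \<Rightarrow> int set \<Rightarrow> (nat \<Rightarrow> 'w \<Rightarrow> int \<Rightarrow> int) \<Rightarrow> bool" where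
  "myopic M g I \<sigma> \<longleftrightarrow> (\<exists>k. k_myopic M g I k \<sigma>)"

text \<open>\<open>plays M g \<sigma> [x\<^sub>1, \<dots>, x\<^sub>r] i\<close> renders the notation \<open>\<sigma>(x\<^sub>1\<dots>x\<^sub>r) = i\<close>.\<close>

definition plays ::
  "'w measure \<Rightarrow> (int \<Rightarrow> 'w \<Rightarrow> real) \<Rightarrow> (nat \<Rightarrow> 'w \<Rightarrow> int \<Rightarrow> int) \<Rightarrow> real list \<Rightarrow> int \<Rightarrow> bool" where
  "plays M g \<sigma> xs i \<longleftrightarrow>
     (\<forall>\<omega>\<in>space M. \<forall>z m. window g (length xs) \<omega> (state \<sigma> \<omega> z m) = xs \<longrightarrow> \<sigma> m \<omega> z = i)"

text \<open>
  The two rules below leave the action open where no listed pattern occurs, which happens only on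
  a null event (including the event that some payoff is neither 0 nor 1).
\<close>

definition low_rule :: "'w measure \<Rightarrow> (int \<Rightarrow> 'w \<Rightarrow> real) \<Rightarrow> (nat \<Rightarrow> 'w \<Rightarrow> int \<Rightarrow> int) \<Rightarrow> bool" where
  "low_rule M g \<sigma> \<longleftrightarrow>
     plays M g \<sigma> [0, 0] 3 \<and> plays M g \<sigma> [0, 1] 1 \<and>
     plays M g \<sigma> [1, 0] 1 \<and> plays M g \<sigma> [1, 1] 1"

definition high_rule :: "'w measure \<Rightarrow> (int \<Rightarrow> 'w \<Rightarrow> real) \<Rightarrow> (nat \<Rightarrow> 'w \<Rightarrow> int \<Rightarrow> int) \<Rightarrow> bool" where
  "high_rule M g \<sigma> \<longleftrightarrow>
     plays M g \<sigma> [0, 0] 3 \<and>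
     (\<forall>k. k mod 3 \<in> {0, 1} \<longrightarrow> plays M g \<sigma> ([0, 1] @ replicate k 0 @ [1]) 3) \<and>
     (\<forall>k. k mod 3 = 2 \<longrightarrow> plays M g \<sigma> ([0, 1] @ replicate k 0 @ [1]) 1) \<and>
     (\<forall>k. k mod 3 \<in> {0, 2} \<longrightarrow> plays M g \<sigma> ([1] @ replicate k 0 @ [1]) 1) \<and>
     (\<forall>k. k mod 3 = 1 \<longrightarrow> plays M g \<sigma> ([1] @ replicate k 0 @ [1]) 3)"

definition p_star :: real where
  "p_star = (THE x. 2 * x ^ 3 - 5 * x ^ 2 + 5 * x - 1 = 0)"

end

theory Submission
  imports Defs
begin

text \<open>
  Along a fixed realization the game is a deterministic control problem. If a function \<open>B\<close> on the
  positions satisfies \<open>payoff + B (new position) \<le> v + B (position)\<close> for both actions and grows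
  sublinearly, then no path has average payoff above \<open>v\<close> in the limit, and a path along which
  equality holds attains \<open>v\<close>.

  Such a \<open>B\<close> exists for each regime: its increments are a function of a nine-state automaton that
  reads the payoffs from right to left, and the word 111 resets the automaton. Up to a telescoping
  term the increment is the centred payoff times a function of the payoffs further ahead (a Poisson
  equation), so its mean vanishes as soon as all words have their expected frequencies, which holds
  almost surely. The Bellman inequalities for the two potentials reduce to \<open>v \<le> 1 / 2\<close> and
  \<open>1 / 2 \<le> v\<close> respectively, and this is where the cubic defining \<open>p_star\<close> comes from.

  A myopic strategy cannot tell the length modulo 3 of a long run of zeros, so above the threshold
  it makes an error of fixed size with positive frequency.
\<close>

section \<open>Normal sequences\<close>

text \<open>A strategy may use the whole realization, so a bound on stage values must hold pathwise
  for all action sequences at once. Hence the argument concerns a single 0-1 sequence with correct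
  word frequencies; probability only shows that almost every realization, read from any vertex, is
  one. For \<open>d y = B y - B (y + 1)\<close> Bellman's equation reads
  \<open>d y = max (x y - v) (x (y + 2) - v - d (y + 1) - d (y + 2))\<close>, a recursion from the
  right. Along runs of zeros its solution has period 3, whence the residues; at the starts
  \<open>1...\<close> and \<open>01...\<close> few pairs of values occur, whence the phases. The
  bound 1/2 arises at \<open>011\<close>: if both ones carry \<open>1 - v\<close>, a step gives
  \<open>- v\<close> and a jump gives \<open>v - 1\<close>. The value \<open>v\<close> is the number
  for which \<open>d\<close> has mean zero under the stationary law of the automaton. Twice the
  numerator minus the denominator of \<open>v\<close> is the cubic for the low rule, and the cubic
  times a positive factor for the high rule, so both values cross 1/2 at \<open>p_star\<close>. The
  obstacle is that \<open>d\<close> depends on infinitely many bits, whereas normality speaks of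
  finite words only.\<close>

definition word_prob :: "real \<Rightarrow> bool list \<Rightarrow> real" where
  "word_prob p w = (\<Prod>b\<leftarrow>w. if b then p else 1 - p)"

definition normal_seq :: "real \<Rightarrow> (nat \<Rightarrow> bool) \<Rightarrow> bool" where
  "normal_seq p x \<longleftrightarrow>
     (\<forall>w. (\<lambda>N. (\<Sum>i<N. of_bool (map x [i..<i + length w] = w)) / real N) \<longlonglongrightarrow> word_prob p w)"

text \<open>The expectation of \<open>F\<close> over \<open>n\<close> independent bits, by
  conditioning on the first one. The recursive form suits the later estimates, which peel off one
  bit or a block of three.\<close>

primrec word_mean :: "real \<Rightarrow> nat \<Rightarrow> (bool list \<Rightarrow> real) \<Rightarrow> real" where
  "word_mean p 0 F = F []"
| "word_mean p (Suc n) F =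
     p * word_mean p n (\<lambda>w. F (True # w)) + (1 - p) * word_mean p n (\<lambda>w. F (False # w))"

lemma word_prob_simps [simp]:
  "word_prob p [] = 1" "word_prob p (b # w) = (if b then p else 1 - p) * word_prob p w"
  by (simp_all add: word_prob_def)

lemma map_upt_Suc: "map x [i..<i + Suc n] = x i # map x [Suc i..<Suc i + n]"
  by (simp add: upt_conv_Cons del: upt_Suc)

lemma word_prob_pos: "0 < p \<Longrightarrow> p < 1 \<Longrightarrow> 0 < word_prob p w"
  by (induction w) auto

lemma lists_length_Suc_bool:
  "{w :: bool list. length w = Suc n} =
     (#) True ` {w. length w = n} \<union> (#) False ` {w. length w = n}"
  by (auto simp: length_Suc_conv image_iff)

lemma finite_bool_lists: "finite {w :: bool list. length w = n}"
  using finite_lists_length_eq[of "UNIV :: bool set" n] by simp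

lemma word_mean_eq_sum: "word_mean p n F = (\<Sum>w | length w = n. word_prob p w * F w)"
proof (induction n arbitrary: F)
  case (Suc n)
  let ?W = "{w :: bool list. length w = n}"
  have "(\<Sum>w | length w = Suc n. word_prob p w * F w) =
      (\<Sum>w\<in>(#) True ` ?W. word_prob p w * F w) + (\<Sum>w\<in>(#) False ` ?W. word_prob p w * F w)"
    unfolding lists_length_Suc_bool
    by (rule sum.union_disjoint) (auto simp: finite_bool_lists)
  also have "\<dots> = word_mean p (Suc n) F"
    by (simp add: sum.reindex Suc sum_distrib_left mult.assoc)
  finally show ?case by simp
qed simp

text \<open>A function of a window of length \<open>n\<close> is a finite combination of indicators
  of words, so normality passes to it by linearity.\<close>

lemma normal_seq_word_mean:
  assumes "normal_seq p x"
  shows "(\<lambda>N. (\<Sum>i<N. F (map x [i..<i + n])) / real N) \<longlonglongrightarrow> word_mean p n F"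
proof -
  let ?W = "{w :: bool list. length w = n}"
  have F: "F (map x [i..<i + n]) = (\<Sum>w\<in>?W. F w * of_bool (map x [i..<i + length w] = w))" for i
  proof -
    have "(\<Sum>w\<in>?W. F w * of_bool (map x [i..<i + length w] = w)) =
        (\<Sum>w\<in>?W. if w = map x [i..<i + n] then F w else 0)"
      by (rule sum.cong) auto
    then show ?thesis by (simp add: finite_bool_lists)
  qed
  have "(\<Sum>i<N. F (map x [i..<i + n])) / real N =
      (\<Sum>w\<in>?W. F w * ((\<Sum>i<N. of_bool (map x [i..<i + length w] = w)) / real N))" for N
    unfolding F by (subst sum.swap) (simp add: sum_divide_distrib sum_distrib_left mult.commute)
  moreover have "(\<lambda>N. \<Sum>w\<in>?W. F w * ((\<Sum>i<N. of_bool (map x [i..<i + length w] = w)) / real N))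
      \<longlonglongrightarrow> (\<Sum>w\<in>?W. F w * word_prob p w)"
    using assms unfolding normal_seq_def by (intro tendsto_sum tendsto_mult tendsto_const) auto
  ultimately show ?thesis
    by (simp add: word_mean_eq_sum mult.commute)
qed

lemma word_mean_mono:
  assumes "0 \<le> p" "p \<le> 1" "\<And>w. F w \<le> G w"
  shows "word_mean p n F \<le> word_mean p n G"
  using assms(3) by (induction n arbitrary: F G) (use assms in \<open>auto intro!: add_mono mult_left_mono\<close>)

lemma word_mean_const: "word_mean p n (\<lambda>_. c) = c"
  by (induction n) (simp_all add: algebra_simps)

lemma normal_seq_infinitely_often:
  assumes "normal_seq p x" "word_prob p w > 0"
  shows "\<exists>i\<ge>m. map x [i..<i + length w] = w"
proof (rule ccontr)
  assume no: "\<not> ?thesis"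
  let ?f = "\<lambda>N. (\<Sum>i<N. of_bool (map x [i..<i + length w] = w)) :: real"
  have "?f N \<le> m" for N
  proof -
    have "?f N \<le> (\<Sum>i<N. of_bool (i < m))"
      using no by (intro sum_mono) (auto simp: not_le)
    also have "\<dots> = real (card ({..<N} \<inter> {..<m}))"
      by (simp add: Int_def of_bool_def sum.If_cases)
    also have "\<dots> \<le> m"
      using card_mono[of "{..<m}" "{..<N} \<inter> {..<m}"] by simp
    finally show ?thesis .
  qed
  then have "(\<lambda>N. ?f N / real N) \<longlonglongrightarrow> 0"
    by (intro tendsto_sandwich[OF _ _ tendsto_const lim_const_over_n[of "real m"]])
       (auto intro!: always_eventually divide_right_mono divide_nonneg_nonneg sum_nonneg)
  with assms(1) have "word_prob p w = 0"
    unfolding normal_seq_def by (blast intro: LIMSEQ_unique)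
  with assms(2) show False by simp
qed

section \<open>Labelling positions by the ones ahead\<close>

datatype residue = R0 | R1 | R2

datatype phase = PA | PB | PC

instance residue :: finite
proof
  have "(UNIV :: residue set) \<subseteq> {R0, R1, R2}" using residue.exhaust by auto
  then show "finite (UNIV :: residue set)" by (rule finite_subset) simp
qed

instance phase :: finite
proof
  have "(UNIV :: phase set) \<subseteq> {PA, PB, PC}" using phase.exhaust by auto
  then show "finite (UNIV :: phase set)" by (rule finite_subset) simp
qed

fun next_residue :: "residue \<Rightarrow> residue" where
  "next_residue R0 = R1" | "next_residue R1 = R2" | "next_residue R2 = R0"

fun turn :: "phase \<Rightarrow> residue \<Rightarrow> phase" where
  "turn PA R0 = PB" | "turn PA R1 = PC" | "turn PA R2 = PA"
| "turn PB R0 = PB" | "turn PB R1 = PA" | "turn PB R2 = PA"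
| "turn PC R0 = PA" | "turn PC R1 = PB" | "turn PC R2 = PA"

text \<open>
  A sequence is read from right to left. The residue is the number modulo 3 of zeros before the
  next one; the phase is determined by the lengths modulo 3 of the later runs of zeros. It encodes the
  pair of values \<open>high_one\<close>, \<open>high_zero_one\<close> below, and \<open>turn\<close> is the recursion that Bellman's
  equation gives for this pair.
\<close>

fun step :: "bool \<Rightarrow> residue \<times> phase \<Rightarrow> residue \<times> phase" where
  "step False (k, s) = (next_residue k, s)"
| "step True (k, s) = (R0, turn s k)"

abbreviation scan :: "bool list \<Rightarrow> residue \<times> phase \<Rightarrow> residue \<times> phase" where
  "scan \<equiv> foldr step"

text \<open>The first one read sets the residue to \<open>R0\<close>. The next two apply
  \<open>turn _ R0\<close> twice, which sends every phase to \<open>PB\<close>; only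
  \<open>PC\<close> needs both turns, passing through \<open>PA\<close>.\<close>

lemma scan_111: "scan [True, True, True] s = (R0, PB)"
proof -
  obtain k t where s: "s = (k, t)" by (cases s)
  show ?thesis unfolding s by (cases k; cases t) simp_all
qed

text \<open>The state at \<open>i\<close> depends on infinitely many bits, so it is defined as the
  eventual value of scans of finite segments. The start \<open>(R0, PB)\<close> is forgotten once
  the segment contains 111.\<close>

definition label :: "(nat \<Rightarrow> bool) \<Rightarrow> nat \<Rightarrow> residue \<times> phase" where
  "label x i = (THE s. \<forall>\<^sub>F N in sequentially. scan (map x [i..<N]) (R0, PB) = s)"

lemma label_eqI:
  assumes "\<forall>\<^sub>F N in sequentially. scan (map x [i..<N]) (R0, PB) = s"
  shows "label x i = s"
  unfolding label_def
proof (rule the_equality)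
  fix t assume "\<forall>\<^sub>F N in sequentially. scan (map x [i..<N]) (R0, PB) = t"
  with assms have "\<forall>\<^sub>F N in sequentially. t = s"
    by eventually_elim simp
  then show "t = s" by simp
qed fact

lemma scan_eventually_label:
  assumes "\<forall>m. \<exists>i\<ge>m. map x [i..<i + 3] = [True, True, True]"
  shows "\<forall>\<^sub>F N in sequentially. scan (map x [i..<N]) (R0, PB) = label x i"
proof -
  from assms[rule_format, of i]
  obtain j where j: "j \<ge> i" "map x [j..<j + 3] = [True, True, True]" by (elim exE conjE)
  have "scan (map x [i..<N]) (R0, PB) = scan (map x [i..<j]) (R0, PB)" if "N \<ge> j + 3" for N
  proof -
    have "[i..<j + (N - j)] = [i..<j] @ [j..<j + (N - j)]"
      using j(1) by (rule upt_add_eq_append)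
    moreover have "[j..<(j + 3) + (N - (j + 3))] = [j..<j + 3] @ [j + 3..<(j + 3) + (N - (j + 3))]"
      by (rule upt_add_eq_append) simp
    moreover have "j + (N - j) = N" "(j + 3) + (N - (j + 3)) = N" using that by simp_all
    ultimately have "[i..<N] = [i..<j] @ [j..<j + 3] @ [j + 3..<N]" by metis
    then have "scan (map x [i..<N]) (R0, PB) =
        scan (map x [i..<j]) (scan (map x [j..<j + 3]) (scan (map x [j + 3..<N]) (R0, PB)))"
      by (metis map_append foldr_append comp_apply)
    then show ?thesis unfolding j(2) scan_111 .
  qed
  then have ev: "\<forall>\<^sub>F N in sequentially. scan (map x [i..<N]) (R0, PB) = scan (map x [i..<j]) (R0, PB)"
    unfolding eventually_sequentially by blast
  from label_eqI[OF this] ev show ?thesis by simp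
qed

lemma label_step:
  assumes "\<forall>m. \<exists>i\<ge>m. map x [i..<i + 3] = [True, True, True]"
  shows "label x i = step (x i) (label x (Suc i))"
proof (rule label_eqI)
  have "\<forall>\<^sub>F N in sequentially. N > i" by (rule eventually_gt_at_top)
  with scan_eventually_label[OF assms, of "Suc i"]
  show "\<forall>\<^sub>F N in sequentially. scan (map x [i..<N]) (R0, PB) = step (x i) (label x (Suc i))"
    by eventually_elim (simp add: upt_conv_Cons)
qed

section \<open>Loss of memory of the automaton and averages over its labels\<close>

definition synced :: "bool list \<Rightarrow> bool" where
  "synced w \<longleftrightarrow> (\<forall>s. scan w s = scan w (R0, PB))"

lemma synced_Cons: "synced w \<Longrightarrow> synced (b # w)"
  unfolding synced_def foldr.simps comp_def by (intro allI arg_cong[where f = "step b"]) blast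

lemma synced_111: "synced (True # True # True # w)"
  using scan_111 by (simp add: synced_def)

text \<open>Each block of three letters is 111 with probability \<open>p ^ 3\<close>. Such a block
  synchronizes the word, and letters added on the left keep it synchronized.\<close>

lemma word_mean_not_synced:
  assumes "0 \<le> p" "p \<le> 1"
  shows "word_mean p (3 * j) (\<lambda>w. of_bool (\<not> synced w)) \<le> (1 - p ^ 3) ^ j"
proof (induction j)
  case (Suc j)
  let ?U = "\<lambda>w. of_bool (\<not> synced w) :: real"
  let ?u = "word_mean p (3 * j) ?U"
  define m where "m = (\<lambda>a b c. word_mean p (3 * j) (\<lambda>w. ?U (a # b # c # w)))"
  have le: "m a b c \<le> ?u" for a b c
    unfolding m_def using assms by (intro word_mean_mono) (auto intro: synced_Cons)
  have zero: "m True True True = 0"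
    by (simp add: m_def synced_111 word_mean_const)
  have q: "0 \<le> 1 - p" using assms by simp
  have Suc3: "3 * Suc j = Suc (Suc (Suc (3 * j)))" by simp
  have "word_mean p (3 * Suc j) ?U =
      p * (p * (p * m True True True + (1 - p) * m True True False) +
           (1 - p) * (p * m True False True + (1 - p) * m True False False)) +
      (1 - p) * (p * (p * m False True True + (1 - p) * m False True False) +
           (1 - p) * (p * m False False True + (1 - p) * m False False False))"
    unfolding Suc3 word_mean.simps m_def ..
  also have "\<dots> \<le>
      p * (p * (p * 0 + (1 - p) * ?u) + (1 - p) * (p * ?u + (1 - p) * ?u)) +
      (1 - p) * (p * (p * ?u + (1 - p) * ?u) + (1 - p) * (p * ?u + (1 - p) * ?u))"
    unfolding zero by (intro add_mono mult_left_mono le assms q order_refl)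
  also have "\<dots> = (1 - p ^ 3) * ?u" by (simp add: algebra_simps power3_eq_cube)
  also have "\<dots> \<le> (1 - p ^ 3) * (1 - p ^ 3) ^ j"
    using Suc assms by (intro mult_left_mono) (auto simp: power_le_one)
  finally show ?case by simp
qed (simp add: of_bool_def)

text \<open>Positivity of \<open>p\<close> guarantees the resets 111; the case \<open>p = 0\<close>
  is handled separately in \<open>low_optimal\<close>.\<close>

locale typical_sequence =
  fixes p :: real and x :: "nat \<Rightarrow> bool"
  assumes p_pos: "0 < p" and p_le: "p \<le> 1" and normal: "normal_seq p x"
begin

abbreviation L :: "nat \<Rightarrow> residue \<times> phase" where
  "L \<equiv> label x"

lemma ones_ahead: "\<exists>i\<ge>m. map x [i..<i + 3] = [True, True, True]"
  using normal_seq_infinitely_often[OF normal, of "[True, True, True]" m] p_pos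
  by (simp add: eval_nat_numeral)

lemma one_ahead: "\<exists>i\<ge>m. x i"
  using ones_ahead[of m] by (auto simp: eval_nat_numeral)

lemma L_step: "L i = step (x i) (L (Suc i))"
  by (intro label_step allI ones_ahead)

lemma L_scan: "L i = scan (map x [i..<i + n]) (L (i + n))"
proof (induction n arbitrary: i)
  case (Suc n)
  have "scan (map x [i..<i + Suc n]) (L (i + Suc n)) =
      step (x i) (scan (map x [Suc i..<Suc i + n]) (L (Suc i + n)))"
    unfolding map_upt_Suc by simp
  with Suc[of "Suc i"] L_step[of i] show ?case by simp
qed simp

text \<open>If the label is cut off after \<open>n\<close> bits, the bit at \<open>i\<close> and the
  bits ahead occupy disjoint places of one window, and the mean is exactly 0. The cut changes a term
  only if those \<open>n\<close> bits are not synchronizing, which for \<open>n = 3 * j\<close> has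
  limiting frequency at most \<open>(1 - p ^ 3) ^ j\<close>.\<close>

lemma mean_innovation:
  fixes h :: "residue \<times> phase \<Rightarrow> real"
  shows "(\<lambda>N. (\<Sum>i<N. (of_bool (x i) - p) * h (L (Suc i))) / real N) \<longlonglongrightarrow> 0"
proof -
  define f where "f = (\<lambda>i. (of_bool (x i) - p) * h (L (Suc i)))"
  define F where "F = (\<lambda>w. (of_bool (hd w) - p) * h (scan (tl w) (R0, PB)))"
  define G where "G = (\<lambda>w. of_bool (\<not> synced (tl w)) :: real)"
  define H where "H = Max (range (\<lambda>s. \<bar>h s\<bar>))"
  have hH: "\<bar>h s\<bar> \<le> H" for s
    unfolding H_def by (rule Max_ge) simp_all
  have H0: "H \<ge> 0" using hH[of "(R0, PA)"] by linarith
  have close: "\<bar>f i - F (map x [i..<i + Suc n])\<bar> \<le> 2 * H * G (map x [i..<i + Suc n])" for i n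
  proof -
    let ?w = "map x [Suc i..<Suc i + n]"
    have e: "f i - F (x i # ?w) = (of_bool (x i) - p) * (h (scan ?w (L (Suc i + n))) - h (scan ?w (R0, PB)))"
      using L_scan[of "Suc i" n] by (simp add: f_def F_def algebra_simps)
    have "\<bar>of_bool (x i) - p\<bar> \<le> 1" using p_pos p_le by auto
    then have "\<bar>f i - F (x i # ?w)\<bar> \<le> 1 * \<bar>h (scan ?w (L (Suc i + n))) - h (scan ?w (R0, PB))\<bar>"
      unfolding e abs_mult by (intro mult_right_mono) auto
    also have "\<dots> \<le> 2 * H * G (x i # ?w)"
    proof (cases "synced ?w")
      case True
      then have "scan ?w (L (Suc i + n)) = scan ?w (R0, PB)" unfolding synced_def by blast
      then show ?thesis using H0 by (simp add: G_def)
    next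
      case False
      then show ?thesis using hH[of "scan ?w (L (Suc i + n))"] hH[of "scan ?w (R0, PB)"]
        by (simp add: G_def)
    qed
    finally show ?thesis unfolding map_upt_Suc .
  qed
  have meanF: "word_mean p (Suc n) F = 0" for n
  proof -
    have lin: "word_mean p n (\<lambda>w. c * K w) = c * word_mean p n K" for c K
      by (simp add: word_mean_eq_sum sum_distrib_left mult_ac)
    have "(\<lambda>w. F (True # w)) = (\<lambda>w. (1 - p) * h (scan w (R0, PB)))"
        "(\<lambda>w. F (False # w)) = (\<lambda>w. (- p) * h (scan w (R0, PB)))"
      by (simp_all add: F_def)
    then show ?thesis by (simp only: word_mean.simps lin) simp
  qed
  have meanG: "word_mean p (Suc n) G = word_mean p n (\<lambda>w. of_bool (\<not> synced w))" for n
    by (simp add: G_def algebra_simps)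
  show ?thesis
  proof (rule LIMSEQ_I)
    fix e :: real assume e: "e > 0"
    have "0 \<le> 1 - p ^ 3" "1 - p ^ 3 < 1" using p_pos p_le by (auto simp: power_le_one)
    then have "(\<lambda>j. 2 * H * (1 - p ^ 3) ^ j) \<longlonglongrightarrow> 2 * H * 0"
      by (intro tendsto_mult tendsto_const LIMSEQ_realpow_zero) auto
    then have "\<forall>\<^sub>F j in sequentially. 2 * H * (1 - p ^ 3) ^ j < e"
      using e by (simp add: order_tendsto_iff)
    then obtain j where j: "2 * H * (1 - p ^ 3) ^ j < e"
      by (meson eventually_happens sequentially_bot)
    let ?n = "3 * j"
    have "2 * H * word_mean p (Suc ?n) G \<le> 2 * H * (1 - p ^ 3) ^ j"
      unfolding meanG using H0 p_pos p_le by (intro mult_left_mono word_mean_not_synced) auto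
    with j have lt: "\<bar>word_mean p (Suc ?n) F\<bar> + 2 * H * word_mean p (Suc ?n) G < e"
      by (simp only: meanF abs_zero add_0)
    have "(\<lambda>N. \<bar>(\<Sum>i<N. F (map x [i..<i + Suc ?n])) / real N\<bar> +
        2 * H * ((\<Sum>i<N. G (map x [i..<i + Suc ?n])) / real N))
      \<longlonglongrightarrow> \<bar>word_mean p (Suc ?n) F\<bar> + 2 * H * word_mean p (Suc ?n) G"
      by (intro tendsto_intros normal_seq_word_mean normal)
    then have "\<forall>\<^sub>F N in sequentially. \<bar>(\<Sum>i<N. F (map x [i..<i + Suc ?n])) / real N\<bar> +
        2 * H * ((\<Sum>i<N. G (map x [i..<i + Suc ?n])) / real N) < e"
      using lt by (simp only: order_tendsto_iff)
    then obtain N0 where N0: "\<And>N. N \<ge> N0 \<Longrightarrow>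
        \<bar>(\<Sum>i<N. F (map x [i..<i + Suc ?n])) / real N\<bar> +
        2 * H * ((\<Sum>i<N. G (map x [i..<i + Suc ?n])) / real N) < e"
      unfolding eventually_sequentially by blast
    have "norm ((\<Sum>i<N. f i) / real N - 0) < e" if "N \<ge> N0" for N
    proof -
      have "\<bar>\<Sum>i<N. f i\<bar> \<le> \<bar>\<Sum>i<N. F (map x [i..<i + Suc ?n])\<bar> +
          \<bar>\<Sum>i<N. f i - F (map x [i..<i + Suc ?n])\<bar>"
        by (simp only: sum_subtractf)
      also have "\<bar>\<Sum>i<N. f i - F (map x [i..<i + Suc ?n])\<bar> \<le>
          (\<Sum>i<N. 2 * H * G (map x [i..<i + Suc ?n]))"
        by (rule order_trans[OF sum_abs]) (rule sum_mono, rule close)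
      finally have "\<bar>\<Sum>i<N. f i\<bar> / real N \<le> (\<bar>\<Sum>i<N. F (map x [i..<i + Suc ?n])\<bar> +
          (\<Sum>i<N. 2 * H * G (map x [i..<i + Suc ?n]))) / real N"
        by (intro divide_right_mono) auto
      also have "\<dots> = \<bar>(\<Sum>i<N. F (map x [i..<i + Suc ?n])) / real N\<bar> +
          2 * H * ((\<Sum>i<N. G (map x [i..<i + Suc ?n])) / real N)"
        by (simp only: add_divide_distrib abs_divide sum_distrib_left[symmetric]) simp
      also have "\<dots> < e" using N0[OF that] .
      finally show ?thesis by simp
    qed
    then show "\<exists>N0. \<forall>N\<ge>N0. norm ((\<Sum>i<N. (of_bool (x i) - p) * h (L (Suc i))) / real N - 0) < e"
      unfolding f_def by blast
  qed
qed

end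

section \<open>Paths and potentials\<close>

text \<open>
  A decision maker at position \<open>y\<close> sees the bits \<open>x y, x (y + 1), \<dots>\<close>, so action \<open>a\<close> earns the bit
  with index \<open>y + a - 1\<close>.
\<close>

primrec pos :: "(nat \<Rightarrow> nat) \<Rightarrow> nat \<Rightarrow> nat" where
  "pos c 0 = 0"
| "pos c (Suc m) = pos c m + c m"

definition total_payoff :: "(nat \<Rightarrow> bool) \<Rightarrow> (nat \<Rightarrow> nat) \<Rightarrow> nat \<Rightarrow> real" where
  "total_payoff x c n = (\<Sum>m<n. of_bool (x (pos c m + c m - 1)))"

lemma sum_lessThan_add:
  fixes d :: "nat \<Rightarrow> real"
  shows "(\<Sum>i<y + a. d i) = (\<Sum>i<y. d i) + (\<Sum>i<a. d (y + i))"
  by (induction a) simp_all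

lemma pos_bounds:
  assumes "\<And>m. c m \<in> {1, 3}"
  shows "n \<le> pos c n" "pos c n \<le> 3 * n"
proof (induction n)
  case (Suc n)
  case 1 show ?case using Suc assms[of n] by auto
  case 2 show ?case using Suc assms[of n] by auto
qed simp_all

lemma pos_visits:
  assumes "\<And>m. c m \<in> {1, 3}"
  shows "\<exists>m. y \<le> pos c m \<and> pos c m \<le> y + 2"
proof -
  define m where "m = (LEAST m. y \<le> pos c m)"
  have m: "y \<le> pos c m"
    unfolding m_def by (rule LeastI, rule pos_bounds(1)[OF assms])
  have "pos c m \<le> y + 2"
  proof (cases m)
    case (Suc k)
    then have "\<not> y \<le> pos c k" using not_less_Least[of k "\<lambda>m. y \<le> pos c m"] by (simp add: m_def)
    then show ?thesis using Suc assms[of k] by auto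
  qed simp
  with m show ?thesis by blast
qed

text \<open>The bound is uniform over all positions reachable in \<open>n\<close> stages, so one
  \<open>n\<close> serves all paths. Positions up to \<open>N\<close> contribute a fixed maximum,
  which \<open>e * real n\<close> eventually exceeds.\<close>

lemma sublinear_bound:
  fixes f :: "nat \<Rightarrow> real"
  assumes "(\<lambda>N. f N / real N) \<longlonglongrightarrow> 0" "e > 0"
  shows "\<forall>\<^sub>F n in sequentially. \<forall>y\<le>3 * n. \<bar>f y\<bar> \<le> e * real n"
proof -
  from LIMSEQ_D[OF assms(1), of "e / 3"] assms(2)
  obtain N where N: "\<And>y. y \<ge> N \<Longrightarrow> \<bar>f y / real y\<bar> < e / 3" by auto
  define b where "b = Max ((\<lambda>y. \<bar>f y\<bar>) ` {..N})"
  have b: "\<bar>f y\<bar> \<le> b" if "y \<le> N" for y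
    unfolding b_def using that by (intro Max_ge) auto
  have "\<bar>f y\<bar> \<le> e * real n" if n: "n \<ge> nat \<lceil>b / e\<rceil>" and y: "y \<le> 3 * n" for n y
  proof (cases "y \<le> N")
    case True
    have "b / e \<le> real n" using n by linarith
    then have "b \<le> e * real n" using assms(2) by (simp add: field_simps)
    with b[OF True] show ?thesis by simp
  next
    case False
    then have "\<bar>f y\<bar> < e / 3 * real y" using N[of y] by (simp add: field_simps)
    also have "\<dots> \<le> e / 3 * real (3 * n)"
      using y assms(2) by (intro mult_left_mono) (auto simp del: of_nat_mult)
    finally show ?thesis by simp
  qed
  then show ?thesis unfolding eventually_sequentially by blast
qed

text \<open>
  With \<open>B y = - (\<Sum>i<y. d i)\<close>, nonnegative slack is the inequality
  \<open>payoff + B (y + a) \<le> v + B y\<close>, and the action is optimal for \<open>B\<close> when the slack vanishes.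
\<close>

definition slack :: "real \<Rightarrow> (nat \<Rightarrow> bool) \<Rightarrow> (nat \<Rightarrow> real) \<Rightarrow> nat \<Rightarrow> nat \<Rightarrow> real" where
  "slack v x d y a = v + (\<Sum>i<a. d (y + i)) - of_bool (x (y + a - 1))"

lemma slack_1: "slack v x d y 1 = v + d y - of_bool (x y)"
  and slack_3: "slack v x d y 3 = v + d y + d (y + 1) + d (y + 2) - of_bool (x (y + 2))"
  by (simp_all add: slack_def eval_nat_numeral)

text \<open>Along the path the increments of consecutive moves join to one sum up to
  \<open>pos c n\<close>. The average payoff thus differs from \<open>v\<close> by a negligible term
  and by the slack paid.\<close>

lemma total_eq_slack:
  "total_payoff x c n = real n * v + (\<Sum>i<pos c n. d i) - (\<Sum>m<n. slack v x d (pos c m) (c m))"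
proof (induction n)
  case (Suc n)
  then show ?case using sum_lessThan_add[of d "pos c n" "c n"]
    by (simp add: total_payoff_def slack_def distrib_right)
qed (simp add: total_payoff_def)

locale potential =
  fixes x :: "nat \<Rightarrow> bool" and d :: "nat \<Rightarrow> real" and v :: real
  assumes mean_zero: "(\<lambda>N. (\<Sum>i<N. d i) / real N) \<longlonglongrightarrow> 0"
    and slack_nonneg: "a \<in> {1, 3} \<Longrightarrow> slack v x d y a \<ge> 0"
begin

text \<open>The quantifier over \<open>c\<close> stands inside \<open>eventually\<close>, because
  the maximizing path may change with \<open>n\<close>.\<close>

lemma total_upper:
  assumes "e > 0"
  shows "\<forall>\<^sub>F n in sequentially. \<forall>c. (\<forall>m. c m \<in> {1, 3}) \<longrightarrow> total_payoff x c n \<le> real n * (v + e)"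
  using sublinear_bound[OF mean_zero assms]
proof eventually_elim
  case (elim n)
  show ?case
  proof (intro allI impI)
    fix c :: "nat \<Rightarrow> nat" assume c: "\<forall>m. c m \<in> {1, 3}"
    have "(\<Sum>i<pos c n. d i) \<le> e * real n"
      using elim pos_bounds(2)[of c n] c by (metis abs_le_D1)
    moreover have "(\<Sum>m<n. slack v x d (pos c m) (c m)) \<ge> 0"
      using c by (intro sum_nonneg slack_nonneg) auto
    ultimately show "total_payoff x c n \<le> real n * (v + e)"
      using total_eq_slack[of x c n v d] by (simp add: algebra_simps)
  qed
qed

lemma mean_along_path:
  assumes "\<And>m. c m \<in> {1, 3}"
  shows "(\<lambda>n. (\<Sum>i<pos c n. d i) / real n) \<longlonglongrightarrow> 0"
proof (rule LIMSEQ_I)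
  fix e :: real assume e: "e > 0"
  then have "\<forall>\<^sub>F n in sequentially. \<forall>y\<le>3 * n. \<bar>\<Sum>i<y. d i\<bar> \<le> e / 2 * real n"
    by (intro sublinear_bound mean_zero) simp
  then obtain N where N: "\<And>n. n \<ge> N \<Longrightarrow> \<forall>y\<le>3 * n. \<bar>\<Sum>i<y. d i\<bar> \<le> e / 2 * real n"
    unfolding eventually_sequentially by blast
  have "norm ((\<Sum>i<pos c n. d i) / real n - 0) < e" if "n \<ge> N" for n
  proof (cases "n = 0")
    case False
    have "\<bar>\<Sum>i<pos c n. d i\<bar> \<le> e / 2 * real n"
      using N[OF that] pos_bounds(2)[of c n] assms by blast
    then have "\<bar>\<Sum>i<pos c n. d i\<bar> / real n \<le> e / 2" using False by (simp add: field_simps)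
    also have "e / 2 < e" using e by simp
    finally show ?thesis by simp
  qed (use e in simp)
  then show "\<exists>N. \<forall>n\<ge>N. norm ((\<Sum>i<pos c n. d i) / real n - 0) < e" by blast
qed

lemma average_eq:
  assumes "n > 0"
  shows "total_payoff x c n / real n =
    v + (\<Sum>i<pos c n. d i) / real n - (\<Sum>m<n. slack v x d (pos c m) (c m)) / real n"
  using assms by (simp add: total_eq_slack[of x c n v d] field_simps)

lemma average_tendsto:
  assumes c: "\<And>m. c m \<in> {1, 3}" and "\<And>m. slack v x d (pos c m) (c m) = 0"
  shows "(\<lambda>n. total_payoff x c n / real n) \<longlonglongrightarrow> v"
proof -
  have "(\<lambda>n. v + (\<Sum>i<pos c n. d i) / real n) \<longlonglongrightarrow> v + 0"
    by (intro tendsto_intros mean_along_path c)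
  moreover have "\<forall>\<^sub>F n in sequentially. v + (\<Sum>i<pos c n. d i) / real n = total_payoff x c n / real n"
    using eventually_gt_at_top[of 0] by eventually_elim (simp add: average_eq assms(2))
  ultimately show ?thesis by (auto intro: Lim_transform_eventually)
qed

text \<open>The cost incurred at one position is charged to at most four occurrences of \<open>w\<close>.\<close>

lemma average_less:
  assumes c: "\<And>m. c m \<in> {1, 3}"
    and normal: "normal_seq p x" and w: "word_prob p w > 0" and "\<delta> > 0"
    and cost: "\<And>y. map x [y..<y + length w] = w \<Longrightarrow>
      \<exists>m. y \<le> pos c m \<and> pos c m \<le> y + 3 \<and> slack v x d (pos c m) (c m) \<ge> \<delta>"
    and l: "(\<lambda>n. total_payoff x c n / real n) \<longlonglongrightarrow> l"
  shows "l < v"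
proof -
  define occ where "occ = (\<lambda>y. of_bool (map x [y..<y + length w] = w) :: real)"
  define s where "s = (\<lambda>m. slack v x d (pos c m) (c m))"
  have s0: "s m \<ge> 0" for m using c slack_nonneg by (simp add: s_def)
  \<comment> \<open>The range \<open>n + 3\<close> suffices since
    \<open>m \<le> pos c m \<le> y + 3\<close> and \<open>y < n\<close>; the averages below are
    taken at \<open>n + 3\<close> accordingly.\<close>
  have count: "\<delta> * (\<Sum>y<n. occ y) \<le> 4 * (\<Sum>m<n + 3. s m)" for n
  proof -
    have "\<delta> * occ y \<le> (\<Sum>m<n + 3. of_bool (y \<le> pos c m \<and> pos c m \<le> y + 3) * s m)" if "y < n" for y
    proof (cases "map x [y..<y + length w] = w")
      case True
      from cost[OF True] obtain m where m: "y \<le> pos c m" "pos c m \<le> y + 3" "s m \<ge> \<delta>"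
        unfolding s_def by blast
      have "m < n + 3" using m(2) that pos_bounds(1)[of c m] c by fastforce
      have "\<delta> * occ y \<le> (\<Sum>m\<in>{m}. of_bool (y \<le> pos c m \<and> pos c m \<le> y + 3) * s m)"
        using m True by (simp add: occ_def)
      also have "\<dots> \<le> (\<Sum>m<n + 3. of_bool (y \<le> pos c m \<and> pos c m \<le> y + 3) * s m)"
        using \<open>m < n + 3\<close> s0 by (intro sum_mono2) auto
      finally show ?thesis .
    next
      case False
      then show ?thesis using s0 by (auto simp: occ_def intro!: sum_nonneg)
    qed
    then have "\<delta> * (\<Sum>y<n. occ y) \<le>
        (\<Sum>y<n. \<Sum>m<n + 3. of_bool (y \<le> pos c m \<and> pos c m \<le> y + 3) * s m)"
      unfolding sum_distrib_left by (intro sum_mono) simp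
    also have "\<dots> = (\<Sum>m<n + 3. (\<Sum>y<n. of_bool (y \<le> pos c m \<and> pos c m \<le> y + 3)) * s m)"
      by (subst sum.swap) (simp only: sum_distrib_right)
    also have "\<dots> \<le> (\<Sum>m<n + 3. 4 * s m)"
    proof (intro sum_mono mult_right_mono s0)
      fix m
      have "(\<Sum>y<n. of_bool (y \<le> pos c m \<and> pos c m \<le> y + 3)) =
          real (card ({..<n} \<inter> {y. y \<le> pos c m \<and> pos c m \<le> y + 3}))"
        by (simp add: of_bool_def sum.If_cases)
      also have "card ({..<n} \<inter> {y. y \<le> pos c m \<and> pos c m \<le> y + 3}) \<le> card {pos c m - 3..pos c m}"
        by (rule card_mono) auto
      also have "card {pos c m - 3..pos c m} \<le> 4" by simp
      finally show "(\<Sum>y<n. of_bool (y \<le> pos c m \<and> pos c m \<le> y + 3)) \<le> (4 :: real)" by simp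
    qed
    finally show ?thesis by (simp add: sum_distrib_left)
  qed
  define F where "F = (\<lambda>n. total_payoff x c (n + 3) / real (n + 3))"
  define G where "G = (\<lambda>n. v + (\<Sum>i<pos c (n + 3). d i) / real (n + 3) -
    \<delta> / 4 * ((\<Sum>y<n. occ y) / real n) * (real n / real (n + 3)))"
  have "F \<longlonglongrightarrow> l" unfolding F_def using l by (rule LIMSEQ_ignore_initial_segment)
  moreover have "G \<longlonglongrightarrow> v + 0 - \<delta> / 4 * word_prob p w * 1"
    unfolding G_def
  proof (intro tendsto_intros)
    show "(\<lambda>n. (\<Sum>i<pos c (n + 3). d i) / real (n + 3)) \<longlonglongrightarrow> 0"
      using mean_along_path[OF c] by (rule LIMSEQ_ignore_initial_segment)
    show "(\<lambda>n. (\<Sum>y<n. occ y) / real n) \<longlonglongrightarrow> word_prob p w"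
      using normal unfolding normal_seq_def occ_def by blast
    show "(\<lambda>n. real n / real (n + 3)) \<longlonglongrightarrow> 1" by real_asymp
  qed
  moreover have "F n \<le> G n" if "n \<ge> 1" for n
  proof -
    have "\<delta> / 4 * ((\<Sum>y<n. occ y) / real n) * (real n / real (n + 3)) = \<delta> / 4 * (\<Sum>y<n. occ y) / real (n + 3)"
      using that by simp
    also have "\<dots> \<le> (\<Sum>m<n + 3. s m) / real (n + 3)"
      using count[of n] by (intro divide_right_mono) auto
    finally show ?thesis
      unfolding F_def G_def by (subst average_eq) (simp_all add: s_def)
  qed
  ultimately have "l \<le> v + 0 - \<delta> / 4 * word_prob p w * 1"
    by (intro LIMSEQ_le) auto
  moreover have "\<delta> / 4 * word_prob p w > 0" using w \<open>\<delta> > 0\<close> by simp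
  ultimately show ?thesis by simp
qed

end

section \<open>The two potentials\<close>

text \<open>
  The value \<open>B y - B (y + 1)\<close> that Bellman's equation forces under the two rules, where \<open>a\<close> and
  \<open>b\<close> give it at positions that see \<open>1\<dots>\<close> and \<open>01\<dots>\<close>. More zeros ahead repeat it with period 3,
  except that 1 is subtracted from \<open>a\<close>.
\<close>

fun decrement ::
  "real \<Rightarrow> (phase \<Rightarrow> real) \<Rightarrow> (phase \<Rightarrow> real) \<Rightarrow> bool \<Rightarrow> residue \<times> phase \<Rightarrow> real" where
  "decrement v a b t (R0, s) = a s - of_bool (\<not> t)"
| "decrement v a b t (R1, s) = b s"
| "decrement v a b t (R2, s) = 1 - v - a s - b s"

context typical_sequence
begin

text \<open>
  The hypothesis is a Poisson equation: it splits \<open>K\<close> times the decrement into a telescoping term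
  and the centred bit times a function of the bits further ahead.
\<close>

lemma decrement_mean_zero:
  fixes h :: "residue \<times> phase \<Rightarrow> real"
  assumes "K \<noteq> 0"
    and poisson: "\<And>s. K * ((1 - p) * decrement v a b False (step False s) +
        p * decrement v a b True (step True s)) =
      h s - (1 - p) * h (step False s) - p * h (step True s)"
  shows "(\<lambda>N. (\<Sum>i<N. decrement v a b (x i) (L i)) / real N) \<longlonglongrightarrow> 0"
proof -
  \<comment> \<open>By the Poisson equation, for a fixed label ahead, \<open>K\<close> times the
    decrement plus \<open>h (L i) - h (L (Suc i))\<close> is a function of the bit
    \<open>x i\<close> with mean 0. Such a function is the centred bit times the difference
    \<open>r\<close> of its two values.\<close>
  define r where "r = (\<lambda>s. K * (decrement v a b True (step True s) - decrement v a b False (step False s)) +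
    h (step True s) - h (step False s))"
  have "K * decrement v a b (x i) (L i) =
      (h (L (Suc i)) - h (L i)) + (of_bool (x i) - p) * r (L (Suc i))" for i
    using poisson[of "L (Suc i)"] L_step[of i] by (cases "x i") (simp_all add: r_def algebra_simps)
  then have "(\<Sum>i<N. K * decrement v a b (x i) (L i)) =
      (h (L N) - h (L 0)) + (\<Sum>i<N. (of_bool (x i) - p) * r (L (Suc i)))" for N
    by (simp only: sum.distrib sum_lessThan_telescope[of "\<lambda>i. h (L i)"])
  then have "(\<Sum>i<N. decrement v a b (x i) (L i)) =
      ((h (L N) - h (L 0)) + (\<Sum>i<N. (of_bool (x i) - p) * r (L (Suc i)))) / K" for N
    by (simp only: sum_distrib_left[symmetric] nonzero_eq_divide_eq[OF assms(1)] mult.commute[of _ K])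
  then have eq: "(\<Sum>i<N. decrement v a b (x i) (L i)) / real N =
      ((h (L N) - h (L 0)) / real N + (\<Sum>i<N. (of_bool (x i) - p) * r (L (Suc i))) / real N) / K" for N
    by (simp add: add_divide_distrib diff_divide_distrib divide_divide_eq_left mult.commute)
  define H where "H = Max (range (\<lambda>s. \<bar>h s\<bar>))"
  have hH: "\<bar>h s\<bar> \<le> H" for s
    unfolding H_def by (rule Max_ge) simp_all
  have "(\<lambda>N. (h (L N) - h (L 0)) / real N) \<longlonglongrightarrow> 0"
  proof (rule Lim_null_comparison)
    show "\<forall>\<^sub>F N in sequentially. norm ((h (L N) - h (L 0)) / real N) \<le> 2 * H / real N"
    proof (intro always_eventually allI)
      fix N
      have "\<bar>h (L N) - h (L 0)\<bar> \<le> 2 * H" using hH[of "L N"] hH[of "L 0"] by linarith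
      then show "norm ((h (L N) - h (L 0)) / real N) \<le> 2 * H / real N"
        by (simp add: abs_divide divide_right_mono)
    qed
    show "(\<lambda>N. 2 * H / real N) \<longlonglongrightarrow> 0" by (rule lim_const_over_n)
  qed
  then have "(\<lambda>N. ((h (L N) - h (L 0)) / real N +
      (\<Sum>i<N. (of_bool (x i) - p) * r (L (Suc i))) / real N) / K) \<longlonglongrightarrow> (0 + 0) / K"
    using assms(1) by (intro tendsto_intros mean_innovation)
  then show ?thesis by (simp add: eq)
qed

lemma next_states: "L y = step (x y) (L (y + 1))" "L (y + 1) = step (x (y + 1)) (L (y + 2))"
    "L (y + 2) = step (x (y + 2)) (L (y + 3))"
  using L_step[of y] L_step[of "y + 1"] L_step[of "y + 2"] by (simp_all add: eval_nat_numeral)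

end

section \<open>Values, increments and Bellman inequalities of the two rules\<close>

definition low_value :: "real \<Rightarrow> real" where
  [simp]: "low_value p = p * (3 - 3 * p + p ^ 2) / (1 + p - p ^ 2)"

definition high_numer :: "real \<Rightarrow> real" where
  [simp]: "high_numer p = p * (28 - 90 * p + 127 * p ^ 2 - 98 * p ^ 3 + 43 * p ^ 4 - 10 * p ^ 5 + p ^ 6)"

definition high_denom :: "real \<Rightarrow> real" where
  [simp]: "high_denom p = 12 - 29 * p + 25 * p ^ 2 - 2 * p ^ 3 - 10 * p ^ 4 + 6 * p ^ 5 - p ^ 6"

text \<open>The pairs produced by Bellman's recursion for \<open>v \<ge> 1 / 2\<close>. For
  instance, \<open>PC\<close> arises at \<open>101\<close> when the second one has phase
  \<open>PA\<close>: a jump gives \<open>1 - v + v - (1 - v) = v\<close>, a step only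
  \<open>1 - v\<close>.\<close>

fun high_one :: "real \<Rightarrow> phase \<Rightarrow> real" where
  "high_one v PA = 1 - v" | "high_one v PB = 1 - v" | "high_one v PC = v"

fun high_zero_one :: "real \<Rightarrow> phase \<Rightarrow> real" where
  "high_zero_one v PA = - v" | "high_zero_one v PB = v - 1" | "high_zero_one v PC = - v"

abbreviation low_decrement :: "real \<Rightarrow> bool \<Rightarrow> residue \<times> phase \<Rightarrow> real" where
  "low_decrement v \<equiv> decrement v (\<lambda>_. 1 - v) (\<lambda>_. - v)"

abbreviation high_decrement :: "real \<Rightarrow> bool \<Rightarrow> residue \<times> phase \<Rightarrow> real" where
  "high_decrement v \<equiv> decrement v (high_one v) (high_zero_one v)"

text \<open>
  The correctors solve the Poisson equations \<open>low_poisson\<close> and \<open>high_poisson\<close>, which are linear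
  systems over the states of the automaton.
\<close>

fun low_corrector :: "real \<Rightarrow> residue \<times> phase \<Rightarrow> real" where
  "low_corrector p (R0, s) = 0"
| "low_corrector p (R1, s) = 2 * p - 2 * p ^ 2"
| "low_corrector p (R2, s) = - 2 * p + 4 * p ^ 2 - 2 * p ^ 3"

fun high_corrector :: "real \<Rightarrow> residue \<times> phase \<Rightarrow> real" where
  "high_corrector p (R0, PA) = 2 - 15*p + 39*p^2 - 50*p^3 + 35*p^4 - 13*p^5 + 2*p^6"
| "high_corrector p (R1, PA) = 2 + 3*p - 19*p^2 + 33*p^3 - 28*p^4 + 12*p^5 - 2*p^6"
| "high_corrector p (R2, PA) = 2 - 31*p + 100*p^2 - 152*p^3 + 131*p^4 - 66*p^5 + 18*p^6 - 2*p^7"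
| "high_corrector p (R0, PB) = 0"
| "high_corrector p (R1, PB) = 12 - 69*p + 160*p^2 - 199*p^3 + 147*p^4 - 66*p^5 + 17*p^6 - 2*p^7"
| "high_corrector p (R2, PB) = - 14*p + 46*p^2 - 63*p^3 + 46*p^4 - 18*p^5 + 3*p^6"
| "high_corrector p (R0, PC) = 8 - 60*p + 158*p^2 - 213*p^3 + 166*p^4 - 76*p^5 + 19*p^6 - 2*p^7"
| "high_corrector p (R1, PC) = 8 - 38*p + 74*p^2 - 76*p^3 + 44*p^4 - 14*p^5 + 2*p^6"
| "high_corrector p (R2, PC) = - 4 + 15*p - 26*p^2 + 27*p^3 - 17*p^4 + 6*p^5 - p^6"

text \<open>Averaging a Poisson equation over the stationary law forces the mean decrement to be 0;
  here the residues have weights proportional to 1, \<open>1 - p\<close>,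
  \<open>(1 - p) ^ 2\<close>, and the condition becomes the hypothesis on \<open>v\<close>. The
  corrector is normalized to 0 at \<open>R0\<close>.\<close>

lemma low_poisson:
  assumes "v * (1 + p - p ^ 2) = p * (3 - 3 * p + p ^ 2)"
  shows "(1 + p - p ^ 2) * ((1 - p) * low_decrement v False (step False s) +
        p * low_decrement v True (step True s)) =
      low_corrector p s - (1 - p) * low_corrector p (step False s) - p * low_corrector p (step True s)"
  using assms by (induction p s rule: low_corrector.induct) (simp_all, algebra+)

text \<open>The decrement is affine in \<open>v\<close>, so after multiplication by
  \<open>high_denom p\<close> the hypothesis eliminates \<open>v\<close>. Each of the nine states
  leaves a polynomial identity in \<open>p\<close>, which is why the corrector is free of
  \<open>v\<close>. It is normalized to 0 at \<open>(R0, PB)\<close>, the state created by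
  111.\<close>

lemma high_poisson:
  assumes "v * high_denom p = high_numer p"
  shows "high_denom p * ((1 - p) * high_decrement v False (step False s) +
        p * high_decrement v True (step True s)) =
      high_corrector p s - (1 - p) * high_corrector p (step False s) - p * high_corrector p (step True s)"
  using assms by (induction p s rule: high_corrector.induct) (simp_all, algebra+)

text \<open>Three bits and the state ahead of them determine every term, so the claims are a finite
  check. The bound 1/2 is sharp at \<open>011\<close>, where a jump has slack
  \<open>1 - 2 * v\<close>.\<close>

lemma low_slacks:
  assumes "0 \<le> v" "v \<le> 1 / 2"
  shows "v + low_decrement v t0 (step t0 (step t1 (step t2 s))) - of_bool t0 \<ge> 0"
    and "v + low_decrement v t0 (step t0 (step t1 (step t2 s))) + low_decrement v t1 (step t1 (step t2 s)) +
        low_decrement v t2 (step t2 s) - of_bool t2 \<ge> 0"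
    and "t0 \<or> t1 \<Longrightarrow> v + low_decrement v t0 (step t0 (step t1 (step t2 s))) - of_bool t0 = 0"
    and "\<not> t0 \<Longrightarrow> \<not> t1 \<Longrightarrow> v + low_decrement v t0 (step t0 (step t1 (step t2 s))) +
        low_decrement v t1 (step t1 (step t2 s)) + low_decrement v t2 (step t2 s) - of_bool t2 = 0"
proof -
  obtain k t where s: "s = (k, t)" by (cases s)
  show "v + low_decrement v t0 (step t0 (step t1 (step t2 s))) - of_bool t0 \<ge> 0"
    using assms unfolding s by (cases t0; cases t1; cases t2; cases k; simp)
  show "v + low_decrement v t0 (step t0 (step t1 (step t2 s))) + low_decrement v t1 (step t1 (step t2 s)) +
        low_decrement v t2 (step t2 s) - of_bool t2 \<ge> 0"
    using assms unfolding s by (cases t0; cases t1; cases t2; cases k; simp)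
  show "v + low_decrement v t0 (step t0 (step t1 (step t2 s))) - of_bool t0 = 0" if "t0 \<or> t1"
    using that unfolding s by (cases t0; cases t1; cases t2; cases k; simp)
  show "v + low_decrement v t0 (step t0 (step t1 (step t2 s))) +
        low_decrement v t1 (step t1 (step t2 s)) + low_decrement v t2 (step t2 s) - of_bool t2 = 0"
    if "\<not> t0" "\<not> t1"
    using that unfolding s by (cases t0; cases t1; cases t2; cases k; simp)
qed

text \<open>Here \<open>k1\<close> and \<open>k2\<close> are the residues one and two positions ahead.\<close>

definition high_action :: "bool \<Rightarrow> bool \<Rightarrow> residue \<Rightarrow> residue \<Rightarrow> nat" where
  "high_action t0 t1 k1 k2 =
     (if t0 then if k1 = R1 then 3 else 1
      else if t1 then if k2 = R2 then 1 else 3 else 3)"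

text \<open>The last three parts price the errors of a myopic strategy: leaving 11 by a jump,
  jumping from a one before a positive number of zeros divisible by 3, and stepping where residue 1
  and phase \<open>PA\<close> call for a jump.\<close>

lemma high_slacks:
  assumes "1 / 2 \<le> v" "v \<le> 1"
  shows "v + high_decrement v t0 (step t0 (step t1 (step t2 s))) - of_bool t0 \<ge> 0"
    and "v + high_decrement v t0 (step t0 (step t1 (step t2 s))) + high_decrement v t1 (step t1 (step t2 s)) +
        high_decrement v t2 (step t2 s) - of_bool t2 \<ge> 0"
    and "high_action t0 t1 (fst (step t1 (step t2 s))) (fst (step t2 s)) = 1 \<Longrightarrow>
        v + high_decrement v t0 (step t0 (step t1 (step t2 s))) - of_bool t0 = 0"
    and "high_action t0 t1 (fst (step t1 (step t2 s))) (fst (step t2 s)) = 3 \<Longrightarrow>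
        v + high_decrement v t0 (step t0 (step t1 (step t2 s))) +
        high_decrement v t1 (step t1 (step t2 s)) + high_decrement v t2 (step t2 s) - of_bool t2 = 0"
    and "t0 \<Longrightarrow> t1 \<Longrightarrow>
        v + high_decrement v t0 (step t0 (step t1 (step t2 s))) +
        high_decrement v t1 (step t1 (step t2 s)) + high_decrement v t2 (step t2 s) - of_bool t2 \<ge> 1 - v"
    and "t0 \<Longrightarrow> \<not> t1 \<Longrightarrow> \<not> t2 \<Longrightarrow> fst (step t1 (step t2 s)) = R0 \<Longrightarrow>
        v + high_decrement v t0 (step t0 (step t1 (step t2 s))) +
        high_decrement v t1 (step t1 (step t2 s)) + high_decrement v t2 (step t2 s) - of_bool t2 \<ge> 1 - v"
    and "t0 \<Longrightarrow> step t1 (step t2 s) = (R1, PA) \<Longrightarrow>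
        v + high_decrement v t0 (step t0 (step t1 (step t2 s))) - of_bool t0 = 2 * v - 1"
proof -
  obtain k t where s: "s = (k, t)" by (cases s)
  show "v + high_decrement v t0 (step t0 (step t1 (step t2 s))) - of_bool t0 \<ge> 0"
    using assms unfolding s by (cases t0; cases t1; cases t2; cases k; cases t; simp)
  show "v + high_decrement v t0 (step t0 (step t1 (step t2 s))) + high_decrement v t1 (step t1 (step t2 s)) +
        high_decrement v t2 (step t2 s) - of_bool t2 \<ge> 0"
    using assms unfolding s by (cases t0; cases t1; cases t2; cases k; cases t; simp)
  show "v + high_decrement v t0 (step t0 (step t1 (step t2 s))) - of_bool t0 = 0"
    if "high_action t0 t1 (fst (step t1 (step t2 s))) (fst (step t2 s)) = 1"
    using that unfolding s high_action_def by (cases t0; cases t1; cases t2; cases k; cases t; simp)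
  show "v + high_decrement v t0 (step t0 (step t1 (step t2 s))) +
        high_decrement v t1 (step t1 (step t2 s)) + high_decrement v t2 (step t2 s) - of_bool t2 = 0"
    if "high_action t0 t1 (fst (step t1 (step t2 s))) (fst (step t2 s)) = 3"
    using that unfolding s high_action_def by (cases t0; cases t1; cases t2; cases k; cases t; simp)
  show "v + high_decrement v t0 (step t0 (step t1 (step t2 s))) +
        high_decrement v t1 (step t1 (step t2 s)) + high_decrement v t2 (step t2 s) - of_bool t2 \<ge> 1 - v"
    if "t0" "t1"
    using that assms unfolding s by (cases t0; cases t1; cases t2; cases k; cases t; simp)
  show "v + high_decrement v t0 (step t0 (step t1 (step t2 s))) +
        high_decrement v t1 (step t1 (step t2 s)) + high_decrement v t2 (step t2 s) - of_bool t2 \<ge> 1 - v"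
    if "t0" "\<not> t1" "\<not> t2" "fst (step t1 (step t2 s)) = R0"
    using that assms unfolding s by (cases t0; cases t1; cases t2; cases k; cases t; simp)
  show "v + high_decrement v t0 (step t0 (step t1 (step t2 s))) - of_bool t0 = 2 * v - 1"
    if "t0" "step t1 (step t2 s) = (R1, PA)"
    using that assms unfolding s by (cases t0; cases t1; cases t2; cases k; cases t; simp)
qed

section \<open>The threshold\<close>

text \<open>In terms of \<open>x + y\<close> and \<open>y - x\<close> the difference quotient is a
  quadratic; completing the square leaves the constant 5/6.\<close>

lemma cubic_strict_mono:
  fixes x y :: real
  assumes "x < y"
  shows "2 * x ^ 3 - 5 * x ^ 2 + 5 * x - 1 < 2 * y ^ 3 - 5 * y ^ 2 + 5 * y - 1"
proof -
  have "(2 * y ^ 3 - 5 * y ^ 2 + 5 * y - 1) - (2 * x ^ 3 - 5 * x ^ 2 + 5 * x - 1) =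
      (y - x) * ((y - x) ^ 2 / 2 + 3 / 2 * (x + y - 5 / 3) ^ 2 + 5 / 6)"
    by (simp add: field_simps power2_eq_square power3_eq_cube)
  also have "\<dots> > 0" using assms by (intro mult_pos_pos add_nonneg_pos add_nonneg_nonneg) auto
  finally show ?thesis by simp
qed

lemma p_star_root: "2 * p_star ^ 3 - 5 * p_star ^ 2 + 5 * p_star - 1 = 0"
  and p_star_unique: "\<exists>!x::real. 2 * x ^ 3 - 5 * x ^ 2 + 5 * x - 1 = 0"
  and p_star_approx: "\<bar>p_star - 0.26102\<bar> \<le> 0.000005"
proof -
  let ?f = "\<lambda>x::real. 2 * x ^ 3 - 5 * x ^ 2 + 5 * x - 1"
  \<comment> \<open>The bracket is the interval of the claimed accuracy, so existence and
    approximation come together.\<close>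
  have "\<exists>x. 0.261015 \<le> x \<and> x \<le> 0.261025 \<and> ?f x = 0"
    by (intro IVT') (auto simp: power_divide intro!: continuous_intros)
  then obtain r where r: "0.261015 \<le> r" "r \<le> 0.261025" "?f r = 0" by blast
  have uniq: "x = r" if "?f x = 0" for x
    using cubic_strict_mono[of x r] cubic_strict_mono[of r x] that r(3) by (cases x r rule: linorder_cases) auto
  then have "p_star = r" unfolding p_star_def by (intro the_equality r(3) uniq)
  then show "?f p_star = 0" using r(3) by simp
  show "\<bar>p_star - 0.26102\<bar> \<le> 0.000005" using r(1,2) unfolding \<open>p_star = r\<close> abs_le_iff by (intro conjI; simp)
  show "\<exists>!x::real. ?f x = 0" using r(3) uniq by blast
qed

lemma cubic_sign:
  "2 * p ^ 3 - 5 * p ^ 2 + 5 * p - 1 \<le> 0 \<longleftrightarrow> p \<le> p_star"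
  "2 * p ^ 3 - 5 * p ^ 2 + 5 * p - 1 \<ge> 0 \<longleftrightarrow> p \<ge> p_star"
  "2 * p ^ 3 - 5 * p ^ 2 + 5 * p - 1 > 0 \<longleftrightarrow> p > p_star"
  using cubic_strict_mono[of p p_star] cubic_strict_mono[of p_star p] p_star_root
  by (cases p p_star rule: linorder_cases; simp)+

lemma p_star_pos: "0 < p_star"
  using abs_le_D2[OF p_star_approx] by simp

lemma low_value_bounds:
  assumes "0 \<le> p" "p \<le> 1"
  shows "low_value p * (1 + p - p ^ 2) = p * (3 - 3 * p + p ^ 2)" "0 \<le> low_value p"
    and "p \<le> p_star \<Longrightarrow> low_value p \<le> 1 / 2"
proof -
  have "p ^ 2 \<le> p" using assms by (simp add: power2_eq_square mult_left_le)
  then have pos: "1 + p - p ^ 2 > 0" using assms by linarith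
  have "3 - 3 * p + p ^ 2 \<ge> 0" using assms by (intro add_nonneg_nonneg) auto
  then show "0 \<le> low_value p" using pos assms by simp
  show "low_value p * (1 + p - p ^ 2) = p * (3 - 3 * p + p ^ 2)" using pos by simp
  show "low_value p \<le> 1 / 2" if "p \<le> p_star"
    using that cubic_sign(1)[of p] pos by (simp add: field_simps power2_eq_square power3_eq_cube)
qed

text \<open>In powers of \<open>q = 1 - p\<close> positivity on the unit interval is visible term by
  term; the only negative coefficient, that of \<open>q ^ 6\<close> in the denominator, is absorbed
  into \<open>q ^ 4 * (1 - q ^ 2)\<close>. The cubic splits off from twice the numerator minus the
  denominator.\<close>

lemma high_value_bounds:
  assumes "0 \<le> p" "p \<le> 1"
  defines "v \<equiv> high_numer p / high_denom p"
  shows "v * high_denom p = high_numer p" "v \<le> 1"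
    and "p_star \<le> p \<Longrightarrow> 1 / 2 \<le> v" "p_star < p \<Longrightarrow> 1 / 2 < v" "p < 1 \<Longrightarrow> v < 1"
proof -
  define q where "q = 1 - p"
  have p: "p = 1 - q" and q: "0 \<le> q" "q \<le> 1" using assms by (auto simp: q_def)
  have "high_denom p = 1 + q + 4 * q ^ 2 + 2 * q ^ 3 + 4 * q ^ 4 + q ^ 4 * (1 - q ^ 2)"
    unfolding p by (simp add: field_simps eval_nat_numeral)
  also have "\<dots> > 0" using q by (intro add_pos_nonneg mult_nonneg_nonneg) (auto simp: power_le_one)
  finally have pos: "high_denom p > 0" .
  show "v * high_denom p = high_numer p" using pos by (simp add: v_def)
  have gap: "high_denom p - high_numer p = q ^ 3 * (2 + 3 * q + 4 * q ^ 2 + 2 * q ^ 3 + q ^ 4)"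
    unfolding p by (simp add: field_simps eval_nat_numeral)
  have gap_pos: "2 + 3 * q + 4 * q ^ 2 + 2 * q ^ 3 + q ^ 4 > 0" using q by (intro add_pos_nonneg) auto
  have "high_denom p - high_numer p \<ge> 0" unfolding gap using q gap_pos by simp
  then show "v \<le> 1" using pos by (simp add: v_def divide_le_eq)
  show "v < 1" if "p < 1"
  proof -
    have "high_denom p - high_numer p > 0" unfolding gap using that gap_pos by (simp add: q_def)
    then show ?thesis using pos by (simp add: v_def divide_less_eq)
  qed
  have half: "2 * high_numer p - high_denom p =
      (2 * p ^ 3 - 5 * p ^ 2 + 5 * p - 1) * (1 + 2 * q + 5 * q ^ 2 + 3 * q ^ 3 + q ^ 4)"
    unfolding p by (simp add: field_simps eval_nat_numeral)
  have half_pos: "1 + 2 * q + 5 * q ^ 2 + 3 * q ^ 3 + q ^ 4 > 0" using q by (intro add_pos_nonneg) auto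
  show "1 / 2 \<le> v" if "p_star \<le> p"
  proof -
    have "2 * high_numer p - high_denom p \<ge> 0"
      unfolding half using that cubic_sign(2)[of p] half_pos by simp
    then show ?thesis using pos by (simp add: v_def le_divide_eq)
  qed
  show "1 / 2 < v" if "p_star < p"
  proof -
    have "2 * high_numer p - high_denom p > 0"
      unfolding half using that cubic_sign(3)[of p] half_pos by simp
    then show ?thesis using pos by (simp add: v_def less_divide_eq)
  qed
qed

section \<open>Optimal and myopic paths\<close>

lemma scan_replicate_False: "scan (replicate n False) (k, s) = ((next_residue ^^ n) k, s)"
  by (induction n) simp_all

lemma next_residue_period: "(next_residue ^^ (3 * j)) k = k"
proof -
  have "(next_residue ^^ 3) = id"
  proof
    fix k show "(next_residue ^^ 3) k = id k" by (cases k) (simp_all add: eval_nat_numeral)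
  qed
  then show ?thesis by (simp add: funpow_mult[symmetric])
qed

lemma next_residue_mod: "(next_residue ^^ n) R0 = (if n mod 3 = 0 then R0 else if n mod 3 = 1 then R1 else R2)"
proof -
  have "(next_residue ^^ n) R0 = (next_residue ^^ (n mod 3 + 3 * (n div 3))) R0" by simp
  also have "\<dots> = (next_residue ^^ (n mod 3)) R0"
    by (simp only: funpow_add comp_apply next_residue_period)
  also have "\<dots> = (if n mod 3 = 0 then R0 else if n mod 3 = 1 then R1 else R2)"
  proof -
    have "n mod 3 = 0 \<or> n mod 3 = 1 \<or> n mod 3 = 2" by auto
    then show ?thesis by (elim disjE) (simp_all add: numeral_2_eq_2)
  qed
  finally show ?thesis .
qed

context typical_sequence
begin

lemma low_potential:
  assumes "p \<le> p_star"
  shows "potential x (\<lambda>i. low_decrement (low_value p) (x i) (L i)) (low_value p)"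
proof
  note v = low_value_bounds[of p]
  have p: "0 \<le> p" "p \<le> 1" using p_pos p_le by auto
  have "p ^ 2 \<le> p" using p by (simp add: power2_eq_square mult_left_le)
  then have "1 + p - p ^ 2 \<noteq> 0" using p by linarith
  then show "(\<lambda>N. (\<Sum>i<N. low_decrement (low_value p) (x i) (L i)) / real N) \<longlonglongrightarrow> 0"
    by (rule decrement_mean_zero) (rule low_poisson[OF v(1)[OF p]])
  fix a y assume "a \<in> {1, 3 :: nat}"
  then show "0 \<le> slack (low_value p) x (\<lambda>i. low_decrement (low_value p) (x i) (L i)) y a"
    using low_slacks(1,2)[OF v(2)[OF p] v(3)[OF p assms], of "x y" "x (y + 1)" "x (y + 2)" "L (y + 3)"]
    by (auto simp: slack_1[simplified] slack_3[simplified] next_states[of y, simplified] simp del: low_value_def)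
qed

lemma low_rule_slack:
  assumes "p \<le> p_star"
  shows "slack (low_value p) x (\<lambda>i. low_decrement (low_value p) (x i) (L i)) y
    (if x y \<or> x (y + 1) then 1 else 3) = 0"
proof -
  have p: "0 \<le> p" "p \<le> 1" using p_pos p_le by auto
  note s = low_slacks(3,4)[OF low_value_bounds(2)[OF p] low_value_bounds(3)[OF p assms],
    of "x y" "x (y + 1)" "x (y + 2)" "L (y + 3)"]
  show ?thesis
  proof (cases "x y \<or> x (y + 1)")
    case True
    then show ?thesis using s(1) by (simp only: if_True slack_1 next_states[of y])
  next
    case False
    then show ?thesis using s(2) by (simp only: if_False slack_3 next_states[of y]) simp
  qed
qed

lemma high_slack_eqs:
  defines "d \<equiv> \<lambda>v i. high_decrement v (x i) (L i)"
  shows "slack v x (d v) y 1 =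
      v + high_decrement v (x y) (step (x y) (step (x (y + 1)) (step (x (y + 2)) (L (y + 3))))) - of_bool (x y)"
    and "slack v x (d v) y 3 =
      v + high_decrement v (x y) (step (x y) (step (x (y + 1)) (step (x (y + 2)) (L (y + 3))))) +
      high_decrement v (x (y + 1)) (step (x (y + 1)) (step (x (y + 2)) (L (y + 3)))) +
      high_decrement v (x (y + 2)) (step (x (y + 2)) (L (y + 3))) - of_bool (x (y + 2))"
  unfolding slack_1 slack_3 d_def by (simp_all only: next_states[of y])

lemma high_potential:
  assumes "p_star \<le> p" and v: "v = high_numer p / high_denom p"
  shows "potential x (\<lambda>i. high_decrement v (x i) (L i)) v"
proof
  have p: "0 \<le> p" "p \<le> 1" using p_pos p_le by auto
  note v' = high_value_bounds[OF p, folded v]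
  \<comment> \<open>Division by zero yields 0, which contradicts
    \<open>v \<ge> 1 / 2\<close>.\<close>
  have "high_denom p \<noteq> 0"
  proof
    assume "high_denom p = 0"
    then have "v = 0" by (simp only: v) simp
    with v'(3)[OF assms(1)] show False by simp
  qed
  then show "(\<lambda>N. (\<Sum>i<N. high_decrement v (x i) (L i)) / real N) \<longlonglongrightarrow> 0"
    by (rule decrement_mean_zero) (rule high_poisson[OF v'(1)])
  fix a y assume "a \<in> {1, 3 :: nat}"
  then show "0 \<le> slack v x (\<lambda>i. high_decrement v (x i) (L i)) y a"
    using high_slacks(1,2)[OF v'(3)[OF assms(1)] v'(2), of "x y" "x (y + 1)" "x (y + 2)" "L (y + 3)"]
    by (auto simp only: high_slack_eqs insert_iff empty_iff)
qed

lemma high_rule_slack: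
  assumes "p_star \<le> p" and v: "v = high_numer p / high_denom p"
  shows "slack v x (\<lambda>i. high_decrement v (x i) (L i)) y
    (high_action (x y) (x (y + 1)) (fst (L (y + 1))) (fst (L (y + 2)))) = 0"
proof -
  have p: "0 \<le> p" "p \<le> 1" using p_pos p_le by auto
  note v' = high_value_bounds[OF p, folded v]
  note s = high_slacks(3,4)[OF v'(3)[OF assms(1)] v'(2), of "x y" "x (y + 1)" "x (y + 2)" "L (y + 3)",
    folded next_states]
  have "high_action (x y) (x (y + 1)) (fst (L (y + 1))) (fst (L (y + 2))) \<in> {1, 3}"
    by (simp add: high_action_def)
  then show ?thesis
    using s by (auto simp only: high_slack_eqs insert_iff empty_iff next_states[symmetric])
qed

lemma residue_of_gap:
  assumes "map x [y..<y + Suc k] = replicate k False @ [True]"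
  shows "fst (L y) = (if k mod 3 = 0 then R0 else if k mod 3 = 1 then R1 else R2)"
proof -
  obtain r s where "L (y + Suc k) = (r, s)" by (cases "L (y + Suc k)")
  then show ?thesis
    unfolding L_scan[of y "Suc k"] assms
    by (simp only: foldr_append comp_apply foldr.simps id_apply step.simps scan_replicate_False
      next_residue_mod fst_conv)
qed

lemma gap_exists: "\<exists>k. map x [y..<y + Suc k] = replicate k False @ [True]"
proof -
  define i where "i = (LEAST i. y \<le> i \<and> x i)"
  have i: "y \<le> i \<and> x i"
    unfolding i_def using one_ahead[of y] by (rule LeastI_ex)
  have "\<not> x j" if "y \<le> j" "j < i" for j
    using not_less_Least[of j "\<lambda>i. y \<le> i \<and> x i"] that by (simp add: i_def)
  then have "map x [y..<y + Suc (i - y)] = replicate (i - y) False @ [True]"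
    using i by (auto simp: list_eq_iff_nth_eq nth_append less_Suc_eq)
  then show ?thesis by blast
qed

text \<open>
  The visible part of the word below forces a fixed action at its last leading one, and the length
  of the run of zeros is chosen such that this action is wrong. The leading ones make sure that
  this position is visited, since leaving them by a jump is wrong, too.
\<close>

lemma myopic_average_less:
  assumes "p_star < p" "p < 1" and v: "v = high_numer p / high_denom p"
    and c: "\<And>m. c m \<in> {1, 3}"
    and myopic: "\<And>m. c m = f (map x [pos c m..<pos c m + k])"
    and l: "(\<lambda>n. total_payoff x c n / real n) \<longlonglongrightarrow> l"
  shows "l < v"
proof -
  have p: "0 \<le> p" "p \<le> 1" using p_pos p_le by auto
  have ps: "p_star \<le> p" using assms(1) by simp
  note v' = high_value_bounds[OF p, folded v]
  note vv = v'(3)[OF ps] v'(2)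
  let ?d = "\<lambda>i. high_decrement v (x i) (L i)"
  interpret potential x ?d v using high_potential[OF ps v] .
  define act where "act = f (take k (True # replicate k False))"
  \<comment> \<open>Both lengths exceed \<open>k\<close>, so the zeros fill the visible window.
    Residue 1 penalizes a step, residue 0 a jump.\<close>
  define n where "n = (if act = 1 then 3 * k + 1 else 3 * k + 3)"
  \<comment> \<open>The suffix 1001 forces phase \<open>PA\<close> at the end of the run whatever
    follows, since \<open>turn\<close> maps \<open>R2\<close> to \<open>PA\<close> from every phase.
    In the other phases a step at residue 1 would cost nothing.\<close>
  define w where "w = [True, True, True, True] @ replicate n False @ [True, False, False, True]"
  \<comment> \<open>Positive only strictly between the thresholds: \<open>v < 1\<close> needs
    \<open>p < 1\<close>, and \<open>v > 1 / 2\<close> needs \<open>p > p_star\<close>.\<close>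
  define \<delta> where "\<delta> = min (1 - v) (2 * v - 1)"
  show ?thesis
  proof (rule average_less[OF c normal _ _ _ l])
    show "word_prob p w > 0" using word_prob_pos[OF p_pos assms(2)] .
    show "\<delta> > 0" using v'(4)[OF assms(1)] v'(5)[OF assms(2)] by (simp add: \<delta>_def)
    fix y assume y: "map x [y..<y + length w] = w"
    have bit: "x (y + i) = w ! i" if "i < length w" for i
      using arg_cong[OF y, of "\<lambda>u. u ! i"] that by simp
    have len: "length w = n + 8" by (simp add: w_def)
    have "w ! i" if "i < 4" for i
      using that by (auto simp: w_def nth_append nth_Cons')
    then have ones: "x (y + i)" if "i < 4" for i
      using bit[of i] that len by simp
    have zeros: "\<not> x (y + 4 + i)" if "i < n" for i
      using bit[of "4 + i"] that len by (simp add: w_def nth_append add.assoc)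
    have tail: "map x [y + 4..<y + 4 + (n + 4)] = replicate n False @ [True, False, False, True]"
    proof (rule nth_equalityI)
      fix i assume "i < length (map x [y + 4..<y + 4 + (n + 4)])"
      then have "i < n + 4" by simp
      then show "map x [y + 4..<y + 4 + (n + 4)] ! i = (replicate n False @ [True, False, False, True]) ! i"
        using bit[of "4 + i"] len by (simp add: w_def nth_append add.assoc)
    qed simp
    have L4: "L (y + 4) = ((next_residue ^^ n) R0, PA)"
    proof -
      obtain r s where rs: "L (y + 4 + (n + 4)) = (r, s)" by (cases "L (y + 4 + (n + 4))")
      have "scan [True, False, False, True] (r, s) = (R0, PA)"
        by (cases s; cases r) simp_all
      then show ?thesis
        unfolding L_scan[of "y + 4" "n + 4"] tail rs by (simp only: foldr_append comp_apply scan_replicate_False)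
    qed
    have jump: "slack v x ?d u 3 \<ge> \<delta>" if "x u" "x (u + 1)" for u
      using high_slacks(5)[OF vv that, of "x (u + 2)" "L (u + 3)"]
      unfolding high_slack_eqs \<delta>_def by linarith
    have last: "slack v x ?d (pos c m) (c m) \<ge> \<delta>" if m: "pos c m = y + 3" for m
    proof -
      have "map x [y + 3..<y + 3 + k] = take k (True # replicate k False)"
      proof (rule nth_equalityI)
        fix i assume "i < length (map x [y + 3..<y + 3 + k])"
        then have i: "i < k" by simp
        show "map x [y + 3..<y + 3 + k] ! i = take k (True # replicate k False) ! i"
        proof (cases i)
          case 0
          then show ?thesis using i ones[of 3] by simp
        next
          case (Suc j)
          then have "j < n" using i by (simp add: n_def)
          then have "\<not> x (y + 3 + i)" using zeros[of j] Suc by (simp add: add.commute add.left_commute)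
          then show ?thesis using i Suc by (simp del: upt_Suc add_Suc_right)
        qed
      qed simp
      then have act: "c m = act" using myopic[of m] m by (simp add: act_def)
      have xy: "x (y + 3)" using ones[of 3] by simp
      show ?thesis
      proof (cases "act = 1")
        case True
        then have "n mod 3 = 1" by (simp add: n_def)
        then have "L (y + 3 + 1) = (R1, PA)" using L4 by (simp add: next_residue_mod add.commute)
        then have "slack v x ?d (y + 3) 1 = 2 * v - 1"
          using high_slacks(7)[OF vv xy, of "x (y + 3 + 1)" "x (y + 3 + 2)" "L (y + 3 + 3)", folded next_states]
          unfolding high_slack_eqs(1)[folded next_states] by blast
        then show ?thesis using act True m by (simp add: \<delta>_def)
      next
        case False
        then have act3: "act = 3" using c[of m] act by auto
        from False have "n mod 3 = 0" by (simp add: n_def)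
        then have "L (y + 3 + 1) = (R0, PA)" using L4 by (simp add: next_residue_mod add.commute)
        moreover have "\<not> x (y + 3 + 1)" "\<not> x (y + 3 + 2)"
          using zeros[of 0] zeros[of 1] False by (simp_all add: n_def add.commute)
        ultimately have "slack v x ?d (y + 3) 3 \<ge> 1 - v"
          using high_slacks(6)[OF vv xy, of "x (y + 3 + 1)" "x (y + 3 + 2)" "L (y + 3 + 3)", folded next_states]
          unfolding high_slack_eqs(2)[folded next_states] by simp
        then show ?thesis using act act3 m by (simp add: \<delta>_def)
      qed
    qed
    have reach: "\<exists>m. y \<le> pos c m \<and> pos c m \<le> y + 3 \<and> slack v x ?d (pos c m) (c m) \<ge> \<delta>"
      if "pos c m + j = y + 3" "j \<le> 3" for m j
      using that
    proof (induction j arbitrary: m)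
      case 0
      then show ?case using last[of m] by (intro exI[of _ m]) simp
    next
      case (Suc j)
      show ?case
      proof (cases "c m = 3")
        case True
        have "y \<le> pos c m" "pos c m < y + 3" using Suc.prems by linarith+
        then have "x (pos c m)" "x (pos c m + 1)"
          using ones[of "pos c m - y"] ones[of "pos c m + 1 - y"] by simp_all
        then show ?thesis using jump True Suc.prems by (intro exI[of _ m]) auto
      next
        case False
        then have "c m = 1" using c[of m] by auto
        then show ?thesis using Suc.IH[of "Suc m"] Suc.prems by simp
      qed
    qed
    obtain m where m: "y \<le> pos c m" "pos c m \<le> y + 2" using pos_visits[of c y] c by blast
    show "\<exists>m. y \<le> pos c m \<and> pos c m \<le> y + 3 \<and> slack v x ?d (pos c m) (c m) \<ge> \<delta>"
      using reach[of m "y + 3 - pos c m"] m by simp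
  qed
qed

end

section \<open>Almost every sequence of payoffs is normal\<close>

lemma map_upt_eq_iff:
  "map f [i..<i + length w] = w \<longleftrightarrow> (\<forall>k<length w. f (i + k) = w ! k)"
proof -
  have "map f [i..<i + length w] = w \<longleftrightarrow>
      (\<forall>k<length w. map f [i..<i + length w] ! k = w ! k)"
    unfolding list_eq_iff_nth_eq by simp
  then show ?thesis by simp
qed

text \<open>Hoeffding's inequality makes the probabilities of a deviation by \<open>e\<close>
  summable in \<open>n\<close>. Borel-Cantelli then applies for each of the countably many
  \<open>e = 1 / (k + 1)\<close>.\<close>

lemma (in prob_space) bounded_strong_law:
  fixes Y :: "nat \<Rightarrow> 'a \<Rightarrow> real"
  assumes indep: "indep_vars (\<lambda>_. borel) Y UNIV"
    and bounded: "\<And>j \<omega>. \<omega> \<in> space M \<Longrightarrow> Y j \<omega> \<in> {0..1}"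
    and mean: "\<And>j. expectation (Y j) = \<mu>"
  shows "AE \<omega> in M. (\<lambda>n. (\<Sum>j<n. Y j \<omega>) / real n) \<longlonglongrightarrow> \<mu>"
proof -
  have Y[measurable]: "Y j \<in> borel_measurable M" for j
    using indep unfolding indep_vars_def by blast
  define A where "A = (\<lambda>e n. {\<omega> \<in> space M. \<bar>(\<Sum>j<n. Y j \<omega>) - real n * \<mu>\<bar> \<ge> e * real n})"
  have A_sets [measurable]: "A e n \<in> sets M" for e n
    unfolding A_def by measurable
  have bound: "measure M (A e n) \<le> 2 * exp (- 2 * e\<^sup>2) ^ n" if "e > 0" for e n
  proof (cases "n = 0")
    case False
    interpret Hoeffding_ineq M "{..<n}" Y "\<lambda>_. 0" "\<lambda>_. 1" "\<Sum>j<n. expectation (Y j)"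
      by unfold_locales (use bounded in \<open>auto intro: indep_vars_subset[OF indep]\<close>)
    have "measure M (A e n) \<le> 2 * exp (-2 * (e * real n)\<^sup>2 / (\<Sum>j<n. (1 - 0)\<^sup>2))"
      using Hoeffding_ineq_abs_ge[of "e * real n"] that False by (simp add: A_def mean)
    also have "\<dots> = 2 * exp (- 2 * e\<^sup>2) ^ n"
      using False by (simp add: power_mult_distrib power2_eq_square exp_of_nat_mult[symmetric] mult_ac)
    finally show ?thesis .
  next
    case True
    have "measure M (A e n) \<le> 1" by simp
    with True show ?thesis by (simp del: prob_le_1)
  qed
  have "AE \<omega> in M. \<forall>\<^sub>F n in sequentially. \<omega> \<in> space M - A e n" if "e > 0" for e
  proof (rule borel_cantelli_AE1)
    have "exp (- 2 * e\<^sup>2) < 1" using that by simp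
    then have "summable (\<lambda>n. 2 * exp (- 2 * e\<^sup>2) ^ n)"
      by (intro summable_mult summable_geometric) simp
    then show "summable (\<lambda>n. measure M (A e n))"
      by (rule summable_comparison_test') (use bound[OF that] in simp)
  qed (auto simp: emeasure_eq_measure)
  then have "AE \<omega> in M. \<forall>k. \<forall>\<^sub>F n in sequentially. \<omega> \<in> space M - A (inverse (real (Suc k))) n"
    unfolding AE_all_countable by simp
  then show ?thesis
  proof eventually_elim
    case (elim \<omega>)
    show ?case
    proof (rule LIMSEQ_I)
      fix e :: real assume "e > 0"
      then obtain k where k: "inverse (real (Suc k)) < e" using reals_Archimedean by blast
      from elim obtain n0 where n0: "\<And>n. n \<ge> n0 \<Longrightarrow> \<omega> \<in> space M - A (inverse (real (Suc k))) n"
        unfolding eventually_sequentially by blast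
      have "norm ((\<Sum>j<n. Y j \<omega>) / real n - \<mu>) < e" if "n \<ge> Suc n0" for n
      proof -
        have n: "n \<ge> n0" "n > 0" using that by auto
        then have "\<bar>(\<Sum>j<n. Y j \<omega>) - real n * \<mu>\<bar> < inverse (real (Suc k)) * real n"
          using n0[of n] by (auto simp: A_def)
        also have "\<dots> < e * real n" using k n by simp
        finally have "\<bar>(\<Sum>j<n. Y j \<omega>) - real n * \<mu>\<bar> / real n < e"
          using n by (simp add: divide_less_eq)
        also have "\<bar>(\<Sum>j<n. Y j \<omega>) - real n * \<mu>\<bar> / real n = \<bar>((\<Sum>j<n. Y j \<omega>) - real n * \<mu>) / real n\<bar>"
          by simp
        also have "((\<Sum>j<n. Y j \<omega>) - real n * \<mu>) / real n = (\<Sum>j<n. Y j \<omega>) / real n - \<mu>"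
          using n by (simp add: diff_divide_distrib)
        finally show ?thesis by simp
      qed
      then show "\<exists>n0. \<forall>n\<ge>n0. norm ((\<Sum>j<n. Y j \<omega>) / real n - \<mu>) < e" by blast
    qed
  qed
qed

lemma sum_residue_classes:
  fixes y :: "nat \<Rightarrow> real"
  shows "(\<Sum>i<m * l. y i) = (\<Sum>r<l. \<Sum>j<m. y (r + j * l))"
proof (induction m)
  case (Suc m)
  have "(\<Sum>i<Suc m * l. y i) = (\<Sum>i<m * l + l. y i)" by (simp add: add.commute)
  also have "\<dots> = (\<Sum>i<m * l. y i) + (\<Sum>r<l. y (m * l + r))"
    by (rule sum_lessThan_add)
  finally show ?case using Suc by (simp add: sum.distrib add.commute)
qed simp

text \<open>Cutting \<open>N\<close> down to a multiple of \<open>l\<close> drops fewer than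
  \<open>l\<close> terms, and what remains is the mean of the \<open>l\<close> class
  averages.\<close>

lemma average_from_residue_classes:
  fixes y :: "nat \<Rightarrow> real"
  assumes l: "l > 0" and y: "\<And>i. y i \<in> {0..1}"
    and classes: "\<And>r. r < l \<Longrightarrow> (\<lambda>m. (\<Sum>j<m. y (r + j * l)) / real m) \<longlonglongrightarrow> \<mu>"
  shows "(\<lambda>N. (\<Sum>i<N. y i) / real N) \<longlonglongrightarrow> \<mu>"
proof -
  define S where "S = (\<lambda>N. \<Sum>i<N. y i)"
  define f where "f = (\<lambda>N. S (N div l * l) / real (N div l) * (real (N div l) / real N))"
  have div: "filterlim (\<lambda>N. N div l) at_top sequentially"
    unfolding filterlim_at_top eventually_sequentially
    using l by (auto simp: less_eq_div_iff_mult_less_eq)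
  have "(\<lambda>m. S (m * l) / real m) \<longlonglongrightarrow> (\<Sum>r<l. \<mu>)"
    unfolding S_def sum_residue_classes sum_divide_distrib[of _ "{..<l}"]
    by (intro tendsto_sum classes) simp
  then have "(\<lambda>N. S (N div l * l) / real (N div l)) \<longlonglongrightarrow> (\<Sum>r<l. \<mu>)"
    by (rule filterlim_compose) (rule div)
  moreover have "(\<lambda>N. real (N div l) / real N) \<longlonglongrightarrow> 1 / real l"
  proof (rule tendsto_sandwich)
    show "(\<lambda>N. (real N / real l - 1) / real N) \<longlonglongrightarrow> 1 / real l"
      using l by (real_asymp simp: inverse_eq_divide)
    have *: "real N / real l - 1 \<le> real (N div l) \<and> real (N div l) \<le> real N / real l" for N
    proof -
      have "real N / real l = (real (N div l) * real l + real (N mod l)) / real l"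
        by (metis div_mult_mod_eq of_nat_add of_nat_mult)
      also have "\<dots> = real (N div l) + real (N mod l) / real l"
        using l by (simp add: add_divide_distrib)
      finally have "real N / real l = real (N div l) + real (N mod l) / real l" .
      moreover have "0 \<le> real (N mod l) / real l" "real (N mod l) / real l \<le> 1"
        using l by (simp_all add: less_imp_le)
      ultimately show ?thesis by linarith
    qed
    show "\<forall>\<^sub>F N in sequentially. (real N / real l - 1) / real N \<le> real (N div l) / real N"
      "\<forall>\<^sub>F N in sequentially. real (N div l) / real N \<le> (real N / real l) / real N"
      using * by (intro always_eventually allI divide_right_mono; simp)+
    show "(\<lambda>N. (real N / real l) / real N) \<longlonglongrightarrow> 1 / real l"
      using l by (real_asymp simp: inverse_eq_divide)
  qed
  ultimately have "f \<longlonglongrightarrow> (\<Sum>r<l. \<mu>) * (1 / real l)"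
    unfolding f_def by (rule tendsto_mult)
  then have "f \<longlonglongrightarrow> \<mu>" using l by simp
  moreover have "(\<lambda>N. S N / real N - f N) \<longlonglongrightarrow> 0"
  proof (rule Lim_null_comparison)
    show "\<forall>\<^sub>F N in sequentially. norm (S N / real N - f N) \<le> real l / real N"
    proof (intro always_eventually allI)
      fix N
      have "S N = S (N div l * l + N mod l)" by simp
      also have "\<dots> = S (N div l * l) + (\<Sum>i<N mod l. y (N div l * l + i))"
        unfolding S_def by (rule sum_lessThan_add)
      finally have "S N - S (N div l * l) = (\<Sum>i<N mod l. y (N div l * l + i))" by simp
      also have "\<bar>\<dots>\<bar> \<le> (\<Sum>i<N mod l. 1)"
        using y by (intro order_trans[OF sum_abs] sum_mono) (auto simp: abs_le_iff intro: order_trans[of _ 0])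
      also have "\<dots> \<le> real l" using l by (simp add: less_imp_le)
      finally have "\<bar>S N - S (N div l * l)\<bar> / real N \<le> real l / real N"
        by (rule divide_right_mono) simp
      moreover have "f N = S (N div l * l) / real N"
        by (cases "N div l = 0") (simp_all add: f_def S_def)
      ultimately show "norm (S N / real N - f N) \<le> real l / real N"
        by (simp add: diff_divide_distrib[symmetric])
    qed
    show "(\<lambda>N. real l / real N) \<longlonglongrightarrow> 0" by (rule lim_const_over_n)
  qed
  ultimately have "(\<lambda>N. f N + (S N / real N - f N)) \<longlonglongrightarrow> \<mu> + 0" by (rule tendsto_add)
  then show ?thesis by (simp add: S_def)
qed

context prob_space
begin

lemma prob_word:
  fixes g :: "int \<Rightarrow> 'a \<Rightarrow> real"
  assumes indep: "indep_vars (\<lambda>_. borel) g UNIV"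
    and p: "\<And>z. prob {\<omega> \<in> space M. g z \<omega> = 1} = p"
    and w: "w \<noteq> []"
  shows "prob {\<omega> \<in> space M. \<forall>k\<in>{..<length w}. (g (b + int k) \<omega> = 1) = w ! k} = word_prob p w"
proof -
  have g [measurable]: "g z \<in> borel_measurable M" for z
    using indep unfolding indep_vars_def by blast
  let ?J = "(\<lambda>k. b + int k) ` {..<length w}"
  let ?A = "\<lambda>i. if w ! nat (i - b) then {1 :: real} else - {1}"
  have "{\<omega> \<in> space M. \<forall>k\<in>{..<length w}. (g (b + int k) \<omega> = 1) = w ! k} =
      (\<Inter>i\<in>?J. g i -` ?A i \<inter> space M)"
    using w by (auto split: if_splits)
  then have "prob {\<omega> \<in> space M. \<forall>k\<in>{..<length w}. (g (b + int k) \<omega> = 1) = w ! k} =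
      (\<Prod>i\<in>?J. prob (g i -` ?A i \<inter> space M))"
    using w by (simp only:) (rule indep_varsD[OF indep], auto)
  also have "\<dots> = (\<Prod>k<length w. prob (g (b + int k) -` ?A (b + int k) \<inter> space M))"
    by (subst prod.reindex) (auto simp: inj_on_def)
  also have "\<dots> = (\<Prod>k<length w. if w ! k then p else 1 - p)"
  proof (rule prod.cong)
    fix k
    have "{\<omega> \<in> space M. g (b + int k) \<omega> = 1} \<in> events" by measurable
    moreover have "g (b + int k) -` {1} \<inter> space M = {\<omega> \<in> space M. g (b + int k) \<omega> = 1}"
      "g (b + int k) -` (- {1}) \<inter> space M = space M - {\<omega> \<in> space M. g (b + int k) \<omega> = 1}"
      by auto
    ultimately show "prob (g (b + int k) -` ?A (b + int k) \<inter> space M) = (if w ! k then p else 1 - p)"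
      by (simp add: p prob_compl)
  qed simp
  also have "\<dots> = word_prob p w"
    by (simp add: word_prob_def prod.list_conv_set_nth atLeast0LessThan)
  finally show ?thesis .
qed

lemma borel_measurable_of_bool:
  assumes [measurable]: "Measurable.pred N P"
  shows "(\<lambda>u. of_bool (P u) :: real) \<in> borel_measurable N"
  by measurable

text \<open>Occurrences of \<open>w\<close> at overlapping places are dependent. At places congruent
  modulo \<open>length w\<close> they are read off disjoint blocks of payoffs, so the strong law
  holds in each residue class.\<close>

lemma normal_seq_AE:
  fixes g :: "int \<Rightarrow> 'a \<Rightarrow> real"
  assumes indep: "indep_vars (\<lambda>_. borel) g UNIV"
    and p: "\<And>z. prob {\<omega> \<in> space M. g z \<omega> = 1} = p"
  shows "AE \<omega> in M. normal_seq p (\<lambda>n. g (b + int n) \<omega> = 1)"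
proof -
  have g [measurable]: "g z \<in> borel_measurable M" for z
    using indep unfolding indep_vars_def by blast
  define hit where "hit = (\<lambda>w i \<omega>. of_bool (\<forall>k\<in>{..<length w}. (g (b + int i + int k) \<omega> = 1) = w ! k) :: real)"
  have classes: "AE \<omega> in M. (\<lambda>m. (\<Sum>j<m. hit w (r + j * length w) \<omega>) / real m) \<longlonglongrightarrow> word_prob p w"
    if w: "w \<noteq> []" for w :: "bool list" and r
  proof (rule bounded_strong_law)
    define l where "l = length w"
    have l: "l > 0" using w by (simp add: l_def)
    define K where "K = (\<lambda>j. (\<lambda>k. b + int (r + j * l) + int k) ` {..<l})"
    have disj: "disjoint_family_on K UNIV"
    proof -
      have "j = j'" if "j * l + k = j' * l + k'" "k < l" "k' < l" for j j' k k'
        using arg_cong[OF that(1), of "\<lambda>i. i div l"] that(2,3) l by simp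
      then show ?thesis
        unfolding disjoint_family_on_def K_def
        by (auto simp: of_nat_add[symmetric] simp del: of_nat_add)
    qed
    have "indep_vars (\<lambda>j. PiM (K j) (\<lambda>_. borel)) (\<lambda>j \<omega>. restrict (\<lambda>i. g i \<omega>) (K j)) UNIV"
      by (rule indep_vars_restrict[OF indep _ disj]) simp
    then have "indep_vars (\<lambda>_. borel) (\<lambda>j \<omega>. of_bool (\<forall>k\<in>{..<l}.
        (restrict (\<lambda>i. g i \<omega>) (K j) (b + int (r + j * l) + int k) = 1) = w ! k) :: real) UNIV"
    proof (rule indep_vars_compose2)
      fix j
      have bit: "Measurable.pred (PiM (K j) (\<lambda>_. borel)) (\<lambda>u. (u (b + int (r + j * l) + int k) = (1::real)) = w ! k)"
        if "k \<in> {..<l}" for k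
      proof -
        have "b + int (r + j * l) + int k \<in> K j" using that by (simp add: K_def)
        then have [measurable]: "(\<lambda>u. u (b + int (r + j * l) + int k)) \<in> borel_measurable (PiM (K j) (\<lambda>_. borel))"
          by (rule measurable_component_singleton)
        show ?thesis by measurable
      qed
      have "Measurable.pred (PiM (K j) (\<lambda>_. borel))
          (\<lambda>u. \<forall>k\<in>{..<l}. (u (b + int (r + j * l) + int k) = (1::real)) = w ! k)"
        by (rule pred_intros_finite(3)) (simp, rule bit)
      then show "(\<lambda>u. of_bool (\<forall>k\<in>{..<l}. (u (b + int (r + j * l) + int k) = (1::real)) = w ! k) :: real)
          \<in> borel_measurable (PiM (K j) (\<lambda>_. borel))"
        by (rule borel_measurable_of_bool)
    qed
    also have "(\<lambda>j \<omega>. of_bool (\<forall>k\<in>{..<l}.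
        (restrict (\<lambda>i. g i \<omega>) (K j) (b + int (r + j * l) + int k) = 1) = w ! k) :: real) =
        (\<lambda>j. hit w (r + j * length w))"
      by (intro ext) (simp add: hit_def K_def l_def)
    finally show "indep_vars (\<lambda>_. borel) (\<lambda>j. hit w (r + j * length w)) UNIV" .
    show "hit w (r + j * length w) \<omega> \<in> {0..1}" for j \<omega> by (simp add: hit_def)
    show "expectation (hit w (r + j * length w)) = word_prob p w" for j
    proof -
      let ?E = "{\<omega> \<in> space M. \<forall>k\<in>{..<length w}. (g (b + int (r + j * length w) + int k) \<omega> = 1) = w ! k}"
      have "?E \<in> events" by measurable
      then have "prob ?E = expectation (indicator ?E)" by simp
      also have "\<dots> = expectation (hit w (r + j * length w))"
        by (rule Bochner_Integration.integral_cong) (auto simp: hit_def indicator_def)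
      finally show ?thesis using prob_word[OF indep p w] by simp
    qed
  qed
  have "AE \<omega> in M. (\<lambda>N. (\<Sum>i<N. of_bool (map (\<lambda>n. g (b + int n) \<omega> = 1) [i..<i + length w] = w)) / real N)
      \<longlonglongrightarrow> word_prob p w" for w :: "bool list"
  proof (cases "w = []")
    case True
    have "(\<lambda>N. real N / real N) \<longlonglongrightarrow> 1" by real_asymp
    then show ?thesis using True by simp
  next
    case False
    have hit: "hit w i \<omega> = of_bool (map (\<lambda>n. g (b + int n) \<omega> = 1) [i..<i + length w] = w)" for i \<omega>
      unfolding hit_def map_upt_eq_iff by (simp add: Ball_def add.assoc)
    have "AE \<omega> in M. \<forall>r. (\<lambda>m. (\<Sum>j<m. hit w (r + j * length w) \<omega>) / real m) \<longlonglongrightarrow> word_prob p w"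
      unfolding AE_all_countable using classes[OF False] by blast
    then show ?thesis
    proof eventually_elim
      case (elim \<omega>)
      show ?case unfolding hit[symmetric]
        by (rule average_from_residue_classes[of "length w"]) (use False elim in \<open>auto simp: hit_def\<close>)
    qed
  qed
  then show ?thesis unfolding normal_seq_def AE_all_countable by (rule allI)
qed

end

lemma bernoulli_percolation_AE:
  assumes "p \<in> {0..1}" "bernoulli_percolation M g p"
  shows "AE \<omega> in M. (\<forall>z. g z \<omega> \<in> {0, 1}) \<and> (\<forall>z. normal_seq p (\<lambda>n. g (z + 1 + int n) \<omega> = 1))"
proof -
  interpret prob_space M using assms(2) by (simp add: bernoulli_percolation_def)
  have indep: "indep_vars (\<lambda>_. borel) g UNIV"
    and distr: "distr M borel (g z) = distr (measure_pmf (bernoulli_pmf p)) borel of_bool" for z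
    using assms(2) by (auto simp: bernoulli_percolation_def)
  have g [measurable]: "g z \<in> borel_measurable M" for z
    using indep unfolding indep_vars_def by blast
  have of_bool [measurable]: "of_bool \<in> borel_measurable (measure_pmf (bernoulli_pmf p))" by simp
  have "prob {\<omega> \<in> space M. g z \<omega> = 1} = p" for z
  proof -
    have "prob {\<omega> \<in> space M. g z \<omega> = 1} = measure (distr M borel (g z)) {1}"
      by (subst measure_distr) (auto simp: vimage_def Int_def conj_commute)
    also have "\<dots> = measure (measure_pmf (bernoulli_pmf p)) (of_bool -` {1 :: real})"
      unfolding distr by (subst measure_distr) auto
    also have "of_bool -` {1 :: real} = {True}" by auto
    finally show ?thesis using assms(1) by (simp add: measure_pmf_single)
  qed
  then have "AE \<omega> in M. \<forall>z. normal_seq p (\<lambda>n. g (z + 1 + int n) \<omega> = 1)"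
    unfolding AE_all_countable by (intro allI normal_seq_AE[OF indep])
  moreover have "AE \<omega> in M. \<forall>z. g z \<omega> \<in> {0, 1}"
    unfolding AE_all_countable
  proof
    fix z
    have "AE y in distr (measure_pmf (bernoulli_pmf p)) borel of_bool. y \<in> {0, 1 :: real}"
      by (subst AE_distr_iff) auto
    then show "AE \<omega> in M. g z \<omega> \<in> {0, 1}"
      unfolding distr[of z, symmetric] by (subst (asm) AE_distr_iff) auto
  qed
  ultimately show ?thesis by eventually_elim blast
qed

section \<open>Strategies\<close>

text \<open>Index 0 is the vertex just right of \<open>z\<close>, reached by action 1.\<close>

definition bits :: "(int \<Rightarrow> 'w \<Rightarrow> real) \<Rightarrow> 'w \<Rightarrow> int \<Rightarrow> nat \<Rightarrow> bool" where
  "bits g \<omega> z n \<longleftrightarrow> g (z + 1 + int n) \<omega> = 1"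

lemma space_payoff_algebra [simp]: "space (payoff_algebra M g) = space M"
  unfolding payoff_algebra_def by (rule space_measure_of) auto

lemma payoff_measurable [measurable]: "g z \<in> borel_measurable (payoff_algebra M g)"
proof (rule measurableI)
  fix A :: "real set" assume "A \<in> sets borel"
  then show "g z -` A \<inter> space (payoff_algebra M g) \<in> sets (payoff_algebra M g)"
    unfolding space_payoff_algebra unfolding payoff_algebra_def
    by (subst sets_measure_of) (auto intro!: sigma_sets.Basic)
qed simp

lemma strategy_in:
  assumes "strategy M g I \<sigma>" "\<omega> \<in> space M"
  shows "\<sigma> m \<omega> z \<in> I"
proof -
  have "(\<lambda>(\<omega>, z). \<sigma> m \<omega> z) \<in> measurable (payoff_algebra M g \<Otimes>\<^sub>M count_space UNIV) (count_space I)"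
    using assms(1) by (simp add: strategy_def)
  from measurable_space[OF this, of "(\<omega>, z)"] assms(2) show ?thesis
    by (simp add: space_pair_measure)
qed

text \<open>There are countably many initial states, so joint measurability reduces to each fixed
  one.\<close>

lemma strategyI:
  assumes "\<And>m z. (\<lambda>\<omega>. \<sigma> m \<omega> z) \<in> measurable (payoff_algebra M g) (count_space I)"
  shows "strategy M g I \<sigma>"
  unfolding strategy_def
proof
  fix m
  have "(\<lambda>x. \<sigma> m (fst x) (snd x)) \<in> measurable (payoff_algebra M g \<Otimes>\<^sub>M count_space UNIV) (count_space I)"
  proof (rule measurable_compose_countable'[where f = "\<lambda>z x. \<sigma> m (fst x) z" and g = snd and I = UNIV])
    show "(\<lambda>x. \<sigma> m (fst x) z) \<in> measurable (payoff_algebra M g \<Otimes>\<^sub>M count_space UNIV) (count_space I)" for z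
      by (rule measurable_compose[OF measurable_fst assms])
  qed auto
  then show "(\<lambda>(\<omega>, z). \<sigma> m \<omega> z) \<in> measurable (payoff_algebra M g \<Otimes>\<^sub>M count_space UNIV) (count_space I)"
    by (simp add: case_prod_beta')
qed

text \<open>A strategy is given the stage and the initial state only, so the current state is
  rebuilt by iterating the move; \<open>state\<close> itself cannot be used, as it takes the
  strategy as argument. \<open>P\<close> marks the states from which to jump.\<close>

definition feedback :: "('w \<Rightarrow> int \<Rightarrow> bool) \<Rightarrow> nat \<Rightarrow> 'w \<Rightarrow> int \<Rightarrow> int" where
  "feedback P m \<omega> z = (if P \<omega> (((\<lambda>y. y + (if P \<omega> y then 3 else 1)) ^^ m) z) then 3 else 1)"

lemma feedback_eq: "feedback P m \<omega> z = (if P \<omega> (state (feedback P) \<omega> z m) then 3 else 1)"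
proof -
  have "state (feedback P) \<omega> z m = ((\<lambda>y. y + (if P \<omega> y then 3 else 1)) ^^ m) z"
    by (induction m) (simp_all add: feedback_def)
  then show ?thesis by (simp add: feedback_def)
qed

lemma stationary_feedback:
  assumes [measurable]: "\<And>y. Measurable.pred (payoff_algebra M g) (\<lambda>\<omega>. P \<omega> y)"
  shows "stationary M g {1, 3} (feedback P)"
  unfolding stationary_def
proof (intro conjI strategyI exI[of _ "\<lambda>\<omega> y. if P \<omega> y then 3 else 1"] ballI allI feedback_eq)
  fix m z
  define T where "T = (\<lambda>n \<omega>. ((\<lambda>y. y + (if P \<omega> y then 3 else 1)) ^^ n) z)"
  have [measurable]: "T n \<in> measurable (payoff_algebra M g) (count_space UNIV)" for n
  proof (induction n)
    case (Suc n)
    have "(\<lambda>\<omega>. T n \<omega> + (if P \<omega> (T n \<omega>) then 3 else 1)) \<in> measurable (payoff_algebra M g) (count_space UNIV)"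
      by (rule measurable_compose_countable[OF _ Suc, of "\<lambda>y \<omega>. y + (if P \<omega> y then 3 else 1)"]) measurable
    then show ?case by (simp add: T_def)
  qed (simp add: T_def)
  have "(\<lambda>\<omega>. if P \<omega> (T m \<omega>) then 3 else 1 :: int) \<in> measurable (payoff_algebra M g) (count_space {1, 3})"
  proof (rule measurable_compose_countable[of "\<lambda>y \<omega>. if P \<omega> y then 3 else 1 :: int" _ _ "T m"])
    fix y
    show "(\<lambda>\<omega>. if P \<omega> y then 3 else 1 :: int) \<in> measurable (payoff_algebra M g) (count_space {1, 3})"
      by (rule measurable_If) (use predE[OF assms[of y]] in auto)
  qed measurable
  then show "(\<lambda>\<omega>. feedback P m \<omega> z) \<in> measurable (payoff_algebra M g) (count_space {1, 3})"
    by (simp add: feedback_def T_def)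
qed

section \<open>Stage values and the passage to paths in a bit sequence\<close>

lemma state_cong:
  assumes "\<And>m. m < n \<Longrightarrow> \<sigma> m \<omega> z = \<tau> m \<omega> z" "k \<le> n"
  shows "state \<sigma> \<omega> z k = state \<tau> \<omega> z k"
  using assms(2) by (induction k) (simp_all add: assms(1))

lemma finite_payoffs:
  assumes "\<omega> \<in> space M" "finite I"
  shows "finite {avg_payoff g \<sigma> n \<omega> z | \<sigma>. strategy M g I \<sigma>}"
proof (rule finite_subset)
  let ?W = "{l. set l \<subseteq> I \<and> length l = n}"
  let ?f = "\<lambda>l. avg_payoff g (\<lambda>m _ _. l ! m) n \<omega> z"
  show "finite (?f ` ?W)" using assms(2) by (intro finite_imageI finite_lists_length_eq)
  show "{avg_payoff g \<sigma> n \<omega> z | \<sigma>. strategy M g I \<sigma>} \<subseteq> ?f ` ?W"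
  proof safe
    fix \<sigma> assume \<sigma>: "strategy M g I \<sigma>"
    let ?l = "map (\<lambda>m. \<sigma> m \<omega> z) [0..<n]"
    have "avg_payoff g \<sigma> n \<omega> z = ?f ?l"
      unfolding avg_payoff_def
      by (intro arg_cong2[of _ _ _ _ "(*)"] refl sum.cong arg_cong2[of _ _ _ _ g] arg_cong2[of _ _ _ _ "(+)"]
          state_cong[of n]) auto
    moreover have "?l \<in> ?W" using strategy_in[OF \<sigma> assms(1)] by auto
    ultimately show "avg_payoff g \<sigma> n \<omega> z \<in> ?f ` ?W" by blast
  qed
qed

lemma stage_value_bounds:
  assumes "\<omega> \<in> space M" "finite I" "strategy M g I \<sigma>"
    and "\<And>\<tau>. strategy M g I \<tau> \<Longrightarrow> avg_payoff g \<tau> n \<omega> z \<le> b"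
  shows "avg_payoff g \<sigma> n \<omega> z \<le> stage_value M g I n \<omega> z" "stage_value M g I n \<omega> z \<le> b"
  unfolding stage_value_def
  by (rule Max_ge[OF finite_payoffs[OF assms(1,2)]], use assms(3) in blast)
     (subst Max_le_iff[OF finite_payoffs[OF assms(1,2)]], use assms(3,4) in blast, use assms(4) in blast)

lemma nat_action: "i \<in> {1, 3 :: int} \<Longrightarrow> nat i \<in> {1, 3}"
  by auto

lemma state_eq_pos:
  assumes "\<And>m. \<sigma> m \<omega> z \<in> {1, 3}"
  shows "state \<sigma> \<omega> z m = z + int (pos (\<lambda>m. nat (\<sigma> m \<omega> z)) m)"
proof (induction m)
  case (Suc m)
  then show ?case using assms[of m] by auto
qed simp

lemma avg_payoff_eq_total:
  assumes "\<And>m. \<sigma> m \<omega> z \<in> {1, 3}" and g: "\<And>z. g z \<omega> \<in> {0, 1}"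
  shows "avg_payoff g \<sigma> n \<omega> z = total_payoff (bits g \<omega> z) (\<lambda>m. nat (\<sigma> m \<omega> z)) n / real n"
proof -
  let ?c = "\<lambda>m. nat (\<sigma> m \<omega> z)"
  have "g (state \<sigma> \<omega> z m + \<sigma> m \<omega> z) \<omega> = of_bool (bits g \<omega> z (pos ?c m + ?c m - 1))" for m
  proof -
    have "state \<sigma> \<omega> z m + \<sigma> m \<omega> z = z + 1 + int (pos ?c m + ?c m - 1)"
    proof -
      have s: "state \<sigma> \<omega> z m = z + int (pos ?c m)" by (rule state_eq_pos) (rule assms(1))
      have "\<sigma> m \<omega> z = 1 \<or> \<sigma> m \<omega> z = 3" using assms(1)[of m] by simp
      then show ?thesis by (elim disjE) (simp_all add: s)
    qed
    then show ?thesis using g[of "state \<sigma> \<omega> z m + \<sigma> m \<omega> z"] by (auto simp: bits_def)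
  qed
  then show ?thesis by (simp add: avg_payoff_def total_payoff_def)
qed

lemma window_eq_bits:
  assumes "\<And>z. g z \<omega> \<in> {0, 1}"
  shows "window g n \<omega> (z + int y) = map of_bool (map (bits g \<omega> z) [y..<y + n])"
proof -
  have "g (z + int y + (1 + int i)) \<omega> = of_bool (bits g \<omega> z (y + i))" for i
    using assms[of "z + int y + (1 + int i)"] by (auto simp: bits_def ac_simps)
  then show ?thesis
    by (intro nth_equalityI) (simp_all add: window_def del: upt_Suc)
qed

text \<open>A squeeze: \<open>upper\<close> bounds all paths simultaneously, hence the maximum
  defining the stage value, and the strategy itself gives the lower bound.\<close>

lemma optimal_if_attains_bound:
  assumes "bernoulli_percolation M g p" "p \<in> {0..1}"
    and \<sigma>: "strategy M g {1, 3} \<sigma>"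
    and upper: "\<And>z. AE \<omega> in M. \<forall>e>0. \<forall>\<^sub>F n in sequentially. \<forall>c. (\<forall>m. c m \<in> {1, 3}) \<longrightarrow>
      total_payoff (bits g \<omega> z) c n \<le> real n * (v + e)"
    and attains: "\<And>z. AE \<omega> in M. (\<lambda>n. avg_payoff g \<sigma> n \<omega> z) \<longlonglongrightarrow> v"
  shows "limit_value M g {1, 3} v" "optimal M g {1, 3} \<sigma>" "uniform_value M g {1, 3} v"
proof -
  show lim: "limit_value M g {1, 3} v"
    unfolding limit_value_def
  proof
    fix z
    show "AE \<omega> in M. (\<lambda>n. stage_value M g {1, 3} n \<omega> z) \<longlonglongrightarrow> v"
      using upper[of z] attains[of z] bernoulli_percolation_AE[OF assms(2,1)] AE_space
    proof eventually_elim
      case (elim \<omega>)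
      have fin: "finite {1, 3 :: int}" by simp
      have g01: "g z \<omega> \<in> {0, 1}" for z using elim(3) by blast
      show ?case
      proof (rule order_tendstoI)
        fix a assume a: "a < v"
        have "\<forall>\<^sub>F n in sequentially. avg_payoff g \<sigma> n \<omega> z > a"
          using elim(2) a by (rule order_tendstoD)
        then show "\<forall>\<^sub>F n in sequentially. stage_value M g {1, 3} n \<omega> z > a"
        proof eventually_elim
          case (elim n)
          \<comment> \<open>The maximum itself serves as the bound \<open>b\<close>.\<close>
          have "avg_payoff g \<tau> n \<omega> z \<le> Max {avg_payoff g \<sigma> n \<omega> z | \<sigma>. strategy M g {1, 3} \<sigma>}"
            if "strategy M g {1, 3} \<tau>" for \<tau>
            using finite_payoffs[OF \<open>\<omega> \<in> space M\<close> fin] that by (intro Max_ge) blast+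
          from stage_value_bounds(1)[OF \<open>\<omega> \<in> space M\<close> fin \<sigma> this] elim show ?case by simp
        qed
      next
        fix a assume a: "v < a"
        define e where "e = (a - v) / 2"
        have e: "e > 0" "v + e < a" using a by (simp_all add: e_def field_simps)
        have "\<forall>\<^sub>F n in sequentially. \<forall>c. (\<forall>m. c m \<in> {1, 3}) \<longrightarrow>
            total_payoff (bits g \<omega> z) c n \<le> real n * (v + e)"
          using elim(1) e(1) by simp
        then show "\<forall>\<^sub>F n in sequentially. stage_value M g {1, 3} n \<omega> z < a"
          using eventually_gt_at_top[of 0]
        proof eventually_elim
          case (elim n)
          have "avg_payoff g \<tau> n \<omega> z \<le> v + e" if \<tau>: "strategy M g {1, 3} \<tau>" for \<tau>
          proof -
            have in13: "\<tau> m \<omega> z \<in> {1, 3}" for m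
              using strategy_in[OF \<tau> \<open>\<omega> \<in> space M\<close>] .
            then have "nat (\<tau> m \<omega> z) \<in> {1, 3}" for m by (rule nat_action)
            then have "total_payoff (bits g \<omega> z) (\<lambda>m. nat (\<tau> m \<omega> z)) n \<le> real n * (v + e)"
              by (intro elim(1)[rule_format])
            then show ?thesis
              using elim(2) by (subst avg_payoff_eq_total[of \<tau> \<omega> z g, OF in13 g01]) (auto simp: divide_le_eq mult.commute)
          qed
          from stage_value_bounds(2)[OF \<open>\<omega> \<in> space M\<close> fin \<sigma> this] e(2) show ?case by simp
        qed
      qed
    qed
  qed
  show "optimal M g {1, 3} \<sigma>"
    unfolding optimal_def using \<sigma> lim attains by blast
  have "AE \<omega> in M. \<forall>\<^sub>F n in sequentially. avg_payoff g \<sigma> n \<omega> z \<ge> v - e" if "e > 0" for e z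
    using attains[of z]
  proof eventually_elim
    case (elim \<omega>)
    have "v - e < v" using that by simp
    from order_tendstoD(1)[OF elim this] show ?case by (rule eventually_mono) simp
  qed
  then show "uniform_value M g {1, 3} v"
    unfolding uniform_value_def using lim \<sigma> by blast
qed

section \<open>Existence of strategies that follow the rules\<close>

lemma window_measurable:
  "Measurable.pred (payoff_algebra M g) (\<lambda>\<omega>. window g n \<omega> y = xs)"
proof -
  have "window g n \<omega> y = xs \<longleftrightarrow> n = length xs \<and> (\<forall>i\<in>{..<length xs}. g (y + int (Suc i)) \<omega> = xs ! i)" for \<omega>
    unfolding list_eq_iff_nth_eq by (auto simp: window_def simp del: upt_Suc)
  moreover have "Measurable.pred (payoff_algebra M g)
      (\<lambda>\<omega>. \<forall>i\<in>{..<length xs}. g (y + int (Suc i)) \<omega> = xs ! i)"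
    by (intro pred_intros_finite) auto
  ultimately show ?thesis by (auto intro: pred_intros_conj1')
qed

lemma low_strategy_exists:
  "\<exists>\<sigma>. k_myopic M g {1, 3} 2 \<sigma> \<and> low_rule M g \<sigma>"
proof -
  define P where "P = (\<lambda>\<omega> y. window g 2 \<omega> y = [0, 0])"
  have "stationary M g {1, 3} (feedback P)"
    by (rule stationary_feedback) (simp only: P_def window_measurable)
  moreover have eq: "feedback P m \<omega> z = (if window g 2 \<omega> (state (feedback P) \<omega> z m) = [0, 0] then 3 else 1)"
    for m \<omega> z
    by (subst feedback_eq) (simp add: P_def)
  ultimately have "k_myopic M g {1, 3} 2 (feedback P)"
    unfolding k_myopic_def by (intro conjI exI[of _ "\<lambda>w. if w = [0, 0] then 3 else 1"]) simp_all
  moreover have "low_rule M g (feedback P)"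
    unfolding low_rule_def plays_def by (simp add: eq numeral_2_eq_2[symmetric])
  ultimately show ?thesis by blast
qed

lemma window_prefix:
  assumes "window g (length xs) \<omega> y = xs" "window g (length ys) \<omega> y = ys" "i < length xs" "i < length ys"
  shows "xs ! i = ys ! i"
proof -
  have "xs ! i = g (y + int (Suc i)) \<omega>" "ys ! i = g (y + int (Suc i)) \<omega>"
    using arg_cong[OF assms(1), of "\<lambda>u. u ! i"] arg_cong[OF assms(2), of "\<lambda>u. u ! i"] assms(3,4)
    by (simp_all add: window_def del: upt_Suc)
  then show ?thesis by simp
qed

lemma window_gap_unique:
  fixes us :: "real list"
  assumes j: "window g (length us + Suc j) \<omega> y = us @ replicate j 0 @ [1]"
    and k: "window g (length us + Suc k) \<omega> y = us @ replicate k 0 @ [1]"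
  shows "j = k"
proof -
  have "\<not> j < k" if "window g (length us + Suc j) \<omega> y = us @ replicate j 0 @ [1]"
    "window g (length us + Suc k) \<omega> y = us @ replicate k 0 @ [1]" for j k
    using window_prefix[of g "us @ replicate j 0 @ [1]" \<omega> y "us @ replicate k 0 @ [1]" "length us + j"] that
    by (auto simp: nth_append)
  from this[OF j k] this[OF k j] show ?thesis by simp
qed

text \<open>The predicate lists the patterns that call for a jump, and a step is the default.
  Patterns prescribing a step exclude all of these, because two different patterns disagree at a
  place that both cover.\<close>

lemma high_strategy_exists:
  "\<exists>\<sigma>. stationary M g {1, 3} \<sigma> \<and> high_rule M g \<sigma>"
proof -
  define P where "P = (\<lambda>\<omega> y. window g 2 \<omega> y = [0, 0] \<or>
    (\<exists>k. k mod 3 \<in> {0, 1} \<and> window g (k + 3) \<omega> y = [0, 1] @ replicate k 0 @ [1]) \<or>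
    (\<exists>k. k mod 3 = 1 \<and> window g (k + 2) \<omega> y = [1] @ replicate k 0 @ [1]))"
  have stat: "stationary M g {1, 3} (feedback P)"
    by (rule stationary_feedback)
       (unfold P_def, intro pred_intros_logic pred_intros_countable window_measurable, simp_all)
  have P_iff: "P \<omega> y \<longleftrightarrow> window g 2 \<omega> y = [0, 0] \<or>
    (\<exists>k. k mod 3 \<in> {0, 1} \<and> window g (k + 3) \<omega> y = [0, 1] @ replicate k 0 @ [1]) \<or>
    (\<exists>k. k mod 3 = 1 \<and> window g (k + 2) \<omega> y = [1] @ replicate k 0 @ [1])" for \<omega> y
    unfolding P_def ..
  have len: "length ([0, 1 :: real] @ replicate k 0 @ [1]) = k + 3"
    "length ([1 :: real] @ replicate k 0 @ [1]) = k + 2"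
    "length [0, 1 :: real] + Suc k = k + 3" "length [1 :: real] + Suc k = k + 2" for k
    by simp_all
  have "high_rule M g (feedback P)"
    unfolding high_rule_def plays_def len
  proof (intro conjI allI impI ballI)
    fix \<omega> z m
    let ?y = "state (feedback P) \<omega> z m"
    assume "window g (length [0, 0 :: real]) \<omega> ?y = [0, 0]"
    then show "feedback P m \<omega> z = 3" by (subst feedback_eq) (simp add: P_iff numeral_2_eq_2)
  next
    fix k :: nat and \<omega> z m
    let ?y = "state (feedback P) \<omega> z m"
    assume k: "k mod 3 \<in> {0, 1}"
      and w: "window g (k + 3) \<omega> ?y = [0, 1] @ replicate k 0 @ [1]"
    then have "P \<omega> ?y" by (subst P_iff) (intro disjI2 disjI1 exI[of _ k] conjI)
    then show "feedback P m \<omega> z = 3" by (subst feedback_eq) simp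
  next
    fix k :: nat and \<omega> z m
    let ?y = "state (feedback P) \<omega> z m"
    assume k: "k mod 3 = 2"
      and w: "window g (k + 3) \<omega> ?y = [0, 1] @ replicate k 0 @ [1]"
    have "window g 2 \<omega> ?y \<noteq> [0, 0]"
      using window_prefix[OF w[folded len], of "[0, 0]" 1] by (auto simp: numeral_2_eq_2)
    moreover have "window g (j + 3) \<omega> ?y \<noteq> [0, 1] @ replicate j 0 @ [1]" if "j mod 3 \<in> {0, 1}" for j
      using window_gap_unique[of g "[0, 1]" j \<omega> ?y k, unfolded len] w that k by auto
    moreover have "window g (j + 2) \<omega> ?y \<noteq> [1] @ replicate j 0 @ [1]" for j
      using window_prefix[OF w[folded len], of "[1] @ replicate j 0 @ [1]" 0, unfolded len] by auto
    ultimately have "\<not> P \<omega> ?y" by (subst P_iff) metis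
    then show "feedback P m \<omega> z = 1" by (subst feedback_eq) simp
  next
    fix k :: nat and \<omega> z m
    let ?y = "state (feedback P) \<omega> z m"
    assume k: "k mod 3 \<in> {0, 2}"
      and w: "window g (k + 2) \<omega> ?y = [1] @ replicate k 0 @ [1]"
    have "window g 2 \<omega> ?y \<noteq> [0, 0]"
      using window_prefix[OF w[folded len], of "[0, 0]" 0] by (auto simp: numeral_2_eq_2)
    moreover have "window g (j + 2) \<omega> ?y \<noteq> [1] @ replicate j 0 @ [1]" if "j mod 3 = 1" for j
      using window_gap_unique[of g "[1]" j \<omega> ?y k, unfolded len] w that k by auto
    moreover have "window g (j + 3) \<omega> ?y \<noteq> [0, 1] @ replicate j 0 @ [1]" for j
      using window_prefix[OF w[folded len], of "[0, 1] @ replicate j 0 @ [1]" 0, unfolded len] by auto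
    ultimately have "\<not> P \<omega> ?y" by (subst P_iff) metis
    then show "feedback P m \<omega> z = 1" by (subst feedback_eq) simp
  next
    fix k :: nat and \<omega> z m
    let ?y = "state (feedback P) \<omega> z m"
    assume k: "k mod 3 = 1"
      and w: "window g (k + 2) \<omega> ?y = [1] @ replicate k 0 @ [1]"
    then have "P \<omega> ?y" by (subst P_iff) (intro disjI2 exI[of _ k] conjI)
    then show "feedback P m \<omega> z = 3" by (subst feedback_eq) simp
  qed
  with stat show ?thesis by blast
qed

section \<open>The rules expressed through bits and labels\<close>

lemma low_rule_action:
  assumes rule: "low_rule M g \<sigma>" and \<omega>: "\<omega> \<in> space M" and g: "\<And>z. g z \<omega> \<in> {0, 1}"
    and y: "state \<sigma> \<omega> z m = z + int y"
  shows "\<sigma> m \<omega> z = (if bits g \<omega> z y \<or> bits g \<omega> z (y + 1) then 1 else 3)"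
proof -
  have w: "window g 2 \<omega> (state \<sigma> \<omega> z m) = [of_bool (bits g \<omega> z y), of_bool (bits g \<omega> z (y + 1))]"
    unfolding y window_eq_bits[of g \<omega> 2 z y, OF g] by (simp add: eval_nat_numeral)
  have plays: "\<sigma> m \<omega> z = i" if "plays M g \<sigma> [a, b] i" "window g 2 \<omega> (state \<sigma> \<omega> z m) = [a, b]" for a b i
    using that \<omega> unfolding plays_def by (simp add: numeral_2_eq_2)
  show ?thesis
    using rule plays[of 0 0 3] plays[of 0 1 1] plays[of 1 0 1] plays[of 1 1 1] w
    unfolding low_rule_def by (cases "bits g \<omega> z y"; cases "bits g \<omega> z (y + 1)") simp_all
qed

lemma map_upt_Cons_iff:
  "map x [y..<y + length (b # w)] = b # w \<longleftrightarrow> x y = b \<and> map x [Suc y..<Suc y + length w] = w"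
proof -
  have "length (b # w) = Suc (length w)" by simp
  then show ?thesis by (simp only: map_upt_Suc list.inject)
qed

text \<open>The block of zeros in a pattern starts one place after a leading 1 and two places after
  a leading 01's first letter, so its length modulo 3 is the residue at \<open>y + 1\<close> and
  \<open>y + 2\<close>, respectively.\<close>

lemma (in typical_sequence) high_rule_action:
  assumes rule: "high_rule M g \<sigma>" and \<omega>: "\<omega> \<in> space M" and g: "\<And>z. g z \<omega> \<in> {0, 1}"
    and y: "state \<sigma> \<omega> z m = z + int y" and x: "x = bits g \<omega> z"
  shows "nat (\<sigma> m \<omega> z) = high_action (x y) (x (y + 1)) (fst (L (y + 1))) (fst (L (y + 2)))"
proof -
  have plays: "\<sigma> m \<omega> z = i"
    if "plays M g \<sigma> (map of_bool w) i" "map x [y..<y + length w] = w" for w i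
    using that \<omega> unfolding plays_def
    by (auto simp: y x window_eq_bits[of g \<omega> _ z y, OF g] simp del: upt_Suc)
  have mod3: "k mod 3 = 0 \<or> k mod 3 = 1 \<or> k mod 3 = 2" for k :: nat by auto
  have len: "length (replicate k False @ [True]) = Suc k" for k by simp
  consider (zz) "\<not> x y" "\<not> x (Suc y)" | (zo) "\<not> x y" "x (Suc y)" | (one) "x y" by blast
  then show ?thesis
  proof cases
    case zz
    have "map x [y..<y + length [False, False]] = [False, False]"
      using zz by simp
    moreover have "plays M g \<sigma> (map of_bool [False, False]) 3"
      using rule by (simp add: high_rule_def)
    ultimately have "\<sigma> m \<omega> z = 3" by (rule plays[rotated])
    then show ?thesis using zz by (simp add: high_action_def)
  next
    case zo
    obtain k where k: "map x [Suc (Suc y)..<Suc (Suc y) + Suc k] = replicate k False @ [True]"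
      using gap_exists by blast
    let ?w = "[False, True] @ replicate k False @ [True]"
    have "map x [y..<y + length ?w] = ?w"
      unfolding append_Cons append_Nil map_upt_Cons_iff len using k zo by (simp del: upt_Suc add_Suc add_Suc_right)
    moreover have "plays M g \<sigma> (map of_bool ?w) (if k mod 3 = 2 then 1 else 3)"
      using rule mod3[of k] unfolding high_rule_def by auto
    ultimately have "\<sigma> m \<omega> z = (if k mod 3 = 2 then 1 else 3)" by (rule plays[rotated])
    then show ?thesis using residue_of_gap[OF k] zo by (auto simp: high_action_def)
  next
    case one
    obtain k where k: "map x [Suc y..<Suc y + Suc k] = replicate k False @ [True]"
      using gap_exists by blast
    let ?w = "[True] @ replicate k False @ [True]"
    have "map x [y..<y + length ?w] = ?w"
      unfolding append_Cons append_Nil map_upt_Cons_iff len using k one by (simp del: upt_Suc add_Suc add_Suc_right)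
    moreover have "plays M g \<sigma> (map of_bool ?w) (if k mod 3 = 1 then 3 else 1)"
      using rule mod3[of k] unfolding high_rule_def by auto
    ultimately have "\<sigma> m \<omega> z = (if k mod 3 = 1 then 3 else 1)" by (rule plays[rotated])
    then show ?thesis using residue_of_gap[OF k] one by (auto simp: high_action_def)
  qed
qed

section \<open>Values and optimality\<close>

context
  fixes M :: "'w measure" and g :: "int \<Rightarrow> 'w \<Rightarrow> real" and p :: real
  assumes p: "p \<in> {0..1}" and percolation: "bernoulli_percolation M g p"
begin

lemma AE_normal:
  "AE \<omega> in M. \<omega> \<in> space M \<and> (\<forall>z. g z \<omega> \<in> {0, 1}) \<and> (\<forall>z. normal_seq p (bits g \<omega> z))"
  using bernoulli_percolation_AE[OF p percolation] AE_space
  by eventually_elim (simp add: bits_def[abs_def])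

text \<open>Both regimes enter through this interface: a potential for every typical realization,
  without slack at the positions that the strategy reaches.\<close>

lemma attains_bound:
  assumes \<sigma>: "strategy M g {1, 3} \<sigma>"
    and potential: "\<And>\<omega> z. \<omega> \<in> space M \<Longrightarrow> (\<And>z. g z \<omega> \<in> {0, 1}) \<Longrightarrow> normal_seq p (bits g \<omega> z) \<Longrightarrow>
      \<exists>d. potential (bits g \<omega> z) d v \<and>
        (\<forall>m y. state \<sigma> \<omega> z m = z + int y \<longrightarrow> slack v (bits g \<omega> z) d y (nat (\<sigma> m \<omega> z)) = 0)"
  shows "limit_value M g {1, 3} v" "optimal M g {1, 3} \<sigma>" "uniform_value M g {1, 3} v"
proof -
  have upper: "AE \<omega> in M. \<forall>e>0. \<forall>\<^sub>F n in sequentially. \<forall>c. (\<forall>m. c m \<in> {1, 3}) \<longrightarrow>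
      total_payoff (bits g \<omega> z) c n \<le> real n * (v + e)" for z
    using AE_normal
  proof eventually_elim
    case (elim \<omega>)
    then obtain d where "potential (bits g \<omega> z) d v" using potential[of \<omega> z] by blast
    then interpret potential "bits g \<omega> z" d v .
    show ?case using total_upper by blast
  qed
  moreover have "AE \<omega> in M. (\<lambda>n. avg_payoff g \<sigma> n \<omega> z) \<longlonglongrightarrow> v" for z
    using AE_normal
  proof eventually_elim
    case (elim \<omega>)
    then obtain d where d: "potential (bits g \<omega> z) d v"
      and slack: "\<And>m y. state \<sigma> \<omega> z m = z + int y \<Longrightarrow> slack v (bits g \<omega> z) d y (nat (\<sigma> m \<omega> z)) = 0"
      using potential[of \<omega> z] by blast
    interpret potential "bits g \<omega> z" d v by fact
    have in13: "\<sigma> m \<omega> z \<in> {1, 3}" for m using strategy_in[OF \<sigma>] elim by blast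
    have g01: "g z \<omega> \<in> {0, 1}" for z using elim by blast
    have "(\<lambda>n. total_payoff (bits g \<omega> z) (\<lambda>m. nat (\<sigma> m \<omega> z)) n / real n) \<longlonglongrightarrow> v"
      by (rule average_tendsto) (rule nat_action[OF in13], rule slack, rule state_eq_pos, rule in13)
    then show ?case using avg_payoff_eq_total[of \<sigma> \<omega> z g, OF in13 g01] by simp
  qed
  ultimately show "limit_value M g {1, 3} v" "optimal M g {1, 3} \<sigma>" "uniform_value M g {1, 3} v"
    using optimal_if_attains_bound[OF percolation p \<sigma>] by blast+
qed

lemma low_optimal:
  assumes "p \<le> p_star" "k_myopic M g {1, 3} 2 \<sigma>" "low_rule M g \<sigma>"
  shows "optimal M g {1, 3} \<sigma>" "uniform_value M g {1, 3} (low_value p)"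
proof -
  have \<sigma>: "strategy M g {1, 3} \<sigma>" using assms(2) by (simp add: k_myopic_def stationary_def)
  have "\<exists>d. potential (bits g \<omega> z) d (low_value p) \<and>
      (\<forall>m y. state \<sigma> \<omega> z m = z + int y \<longrightarrow> slack (low_value p) (bits g \<omega> z) d y (nat (\<sigma> m \<omega> z)) = 0)"
    if \<omega>: "\<omega> \<in> space M" "\<And>z. g z \<omega> \<in> {0, 1}" "normal_seq p (bits g \<omega> z)" for \<omega> z
  proof (cases "p = 0")
    case False
    then interpret typical_sequence p "bits g \<omega> z" using p \<omega>(3) by unfold_locales auto
    have "slack (low_value p) (bits g \<omega> z) (\<lambda>i. low_decrement (low_value p) (bits g \<omega> z i) (L i)) y
        (nat (\<sigma> m \<omega> z)) = 0" if "state \<sigma> \<omega> z m = z + int y" for m y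
      using low_rule_slack[OF assms(1), of y] low_rule_action[OF assms(3) \<omega>(1,2) that]
      by (auto simp del: low_value_def split: if_splits)
    with low_potential[OF assms(1)] show ?thesis by blast
  next
    case True
    \<comment> \<open>Without ones there are no resets, so the bits themselves serve as increments.
      A step then has slack 0, and a jump costs the two bits it skips, which vanish under the low
      rule.\<close>
    let ?d = "\<lambda>i. of_bool (bits g \<omega> z i) :: real"
    have v: "low_value p = 0" using True by simp
    have "potential (bits g \<omega> z) ?d 0"
    proof
      show "(\<lambda>N. (\<Sum>i<N. ?d i) / real N) \<longlonglongrightarrow> 0"
        using \<omega>(3)[unfolded normal_seq_def, rule_format, of "[True]"] True by simp
      show "0 \<le> slack 0 (bits g \<omega> z) ?d y a" if "a \<in> {1, 3}" for a y
        using that slack_1[of 0 "bits g \<omega> z" ?d y] slack_3[of 0 "bits g \<omega> z" ?d y] by auto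
    qed
    moreover have "slack 0 (bits g \<omega> z) ?d y (nat (\<sigma> m \<omega> z)) = 0" if "state \<sigma> \<omega> z m = z + int y" for m y
      using low_rule_action[OF assms(3) \<omega>(1,2) that]
        slack_1[of 0 "bits g \<omega> z" ?d y] slack_3[of 0 "bits g \<omega> z" ?d y] by simp
    ultimately show ?thesis unfolding v by blast
  qed
  from attains_bound[OF \<sigma> this] show "optimal M g {1, 3} \<sigma>" "uniform_value M g {1, 3} (low_value p)"
    by blast+
qed

lemma high_optimal:
  assumes "p_star \<le> p" "stationary M g {1, 3} \<sigma>" "high_rule M g \<sigma>"
  shows "limit_value M g {1, 3} (high_numer p / high_denom p)" "optimal M g {1, 3} \<sigma>"
    "uniform_value M g {1, 3} (high_numer p / high_denom p)"
proof -
  define v where "v = high_numer p / high_denom p"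
  have \<sigma>: "strategy M g {1, 3} \<sigma>" using assms(2) by (simp add: stationary_def)
  have "\<exists>d. potential (bits g \<omega> z) d v \<and>
      (\<forall>m y. state \<sigma> \<omega> z m = z + int y \<longrightarrow> slack v (bits g \<omega> z) d y (nat (\<sigma> m \<omega> z)) = 0)"
    if \<omega>: "\<omega> \<in> space M" "\<And>z. g z \<omega> \<in> {0, 1}" "normal_seq p (bits g \<omega> z)" for \<omega> z
  proof -
    interpret typical_sequence p "bits g \<omega> z" using p \<omega>(3) p_star_pos assms(1) by unfold_locales auto
    have "slack v (bits g \<omega> z) (\<lambda>i. high_decrement v (bits g \<omega> z i) (L i)) y (nat (\<sigma> m \<omega> z)) = 0"
      if "state \<sigma> \<omega> z m = z + int y" for m y
      unfolding high_rule_action[OF assms(3) \<omega>(1,2) that refl]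
      by (rule high_rule_slack[OF assms(1) v_def])
    with high_potential[OF assms(1) v_def] show ?thesis by blast
  qed
  from attains_bound[OF \<sigma> this]
  show "limit_value M g {1, 3} (high_numer p / high_denom p)" "optimal M g {1, 3} \<sigma>"
    "uniform_value M g {1, 3} (high_numer p / high_denom p)"
    unfolding v_def by blast+
qed

text \<open>Limit values are unique, so an optimal strategy has limit average \<open>v\<close>
  almost surely, whereas a myopic one stays strictly below \<open>v\<close> on every typical
  realization where its averages converge.\<close>

lemma myopic_not_optimal:
  assumes "p_star < p" "p < 1" "k_myopic M g {1, 3} k \<sigma>" "optimal M g {1, 3} \<sigma>"
  shows False
proof -
  define v where "v = high_numer p / high_denom p"
  have lim: "limit_value M g {1, 3} v"
    using high_optimal(1) high_strategy_exists[of M g] assms(1) unfolding v_def by force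
  from assms(3) have \<sigma>: "strategy M g {1, 3} \<sigma>" by (simp add: k_myopic_def stationary_def)
  from assms(3) obtain f where f: "\<And>\<omega> z m. \<omega> \<in> space M \<Longrightarrow> \<sigma> m \<omega> z = f (window g k \<omega> (state \<sigma> \<omega> z m))"
    unfolding k_myopic_def by blast
  from assms(4) obtain l where l: "limit_value M g {1, 3} l"
    "\<And>z. AE \<omega> in M. (\<lambda>n. avg_payoff g \<sigma> n \<omega> z) \<longlonglongrightarrow> l"
    unfolding optimal_def by blast
  interpret prob_space M using percolation by (simp add: bernoulli_percolation_def)
  have "AE \<omega> in M. False"
    using AE_normal lim[unfolded limit_value_def, rule_format, of 0]
      l(1)[unfolded limit_value_def, rule_format, of 0] l(2)[of 0]
  proof eventually_elim
    case (elim \<omega>)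
    have "l = v" using elim(2,3) by (rule LIMSEQ_unique[rotated])
    have \<omega>: "\<omega> \<in> space M" and g01: "g z \<omega> \<in> {0, 1}" for z using elim(1) by blast+
    have in13: "\<sigma> m \<omega> 0 \<in> {1, 3}" for m using strategy_in[OF \<sigma> \<omega>] .
    interpret typical_sequence p "bits g \<omega> 0"
      using p p_star_pos assms(1) elim(1) by unfold_locales auto
    let ?c = "\<lambda>m. nat (\<sigma> m \<omega> 0)"
    have "?c m = (nat \<circ> f \<circ> map of_bool) (map (bits g \<omega> 0) [pos ?c m..<pos ?c m + k])" for m
    proof -
      have "state \<sigma> \<omega> 0 m = 0 + int (pos ?c m)" by (rule state_eq_pos) (rule in13)
      then show ?thesis
        using f[OF \<omega>, of m 0] window_eq_bits[of g \<omega> k 0 "pos ?c m", OF g01] by simp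
    qed
    moreover have "(\<lambda>n. total_payoff (bits g \<omega> 0) ?c n / real n) \<longlonglongrightarrow> l"
      using elim(4) avg_payoff_eq_total[of \<sigma> \<omega> 0 g, OF in13 g01] by simp
    ultimately have "l < v"
      using myopic_average_less[OF assms(1,2) v_def, of ?c] nat_action[OF in13] by blast
    with \<open>l = v\<close> show ?case by simp
  qed
  then show False using AE_False by simp
qed

end

theorem proposition4p5:
  fixes M :: "'w measure" and g :: "int \<Rightarrow> 'w \<Rightarrow> real" and p :: real
  assumes "p \<in> {0..1}"
    and "bernoulli_percolation M g p"
  shows
    "(\<exists>!x::real. 2 * x ^ 3 - 5 * x ^ 2 + 5 * x - 1 = 0) \<and>
     \<bar>p_star - 0.26102\<bar> \<le> 0.000005 \<and>
     (p \<le> p_star \<longrightarrow>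
        (\<exists>\<sigma>. k_myopic M g {1, 3} 2 \<sigma> \<and> low_rule M g \<sigma>) \<and>
        (\<forall>\<sigma>. k_myopic M g {1, 3} 2 \<sigma> \<and> low_rule M g \<sigma> \<longrightarrow> optimal M g {1, 3} \<sigma>)) \<and>
     (p_star < p \<and> p < 1 \<longrightarrow>
        \<not> (\<exists>\<sigma>. myopic M g {1, 3} \<sigma> \<and> optimal M g {1, 3} \<sigma>) \<and>
        (\<exists>\<sigma>. stationary M g {1, 3} \<sigma> \<and> high_rule M g \<sigma>) \<and>
        (\<forall>\<sigma>. stationary M g {1, 3} \<sigma> \<and> high_rule M g \<sigma> \<longrightarrow> optimal M g {1, 3} \<sigma>)) \<and>
     (p \<le> p_star \<longrightarrow>
        uniform_value M g {1, 3} (p * (3 - 3 * p + p ^ 2) / (1 + p - p ^ 2))) \<and>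
     (p_star \<le> p \<longrightarrow>
        uniform_value M g {1, 3}
          (p * (28 - 90 * p + 127 * p ^ 2 - 98 * p ^ 3 + 43 * p ^ 4 - 10 * p ^ 5 + p ^ 6) /
           (12 - 29 * p + 25 * p ^ 2 - 2 * p ^ 3 - 10 * p ^ 4 + 6 * p ^ 5 - p ^ 6)))"
proof (intro conjI impI allI notI)
  show "\<exists>!x::real. 2 * x ^ 3 - 5 * x ^ 2 + 5 * x - 1 = 0" by (rule p_star_unique)
  show "\<bar>p_star - 0.26102\<bar> \<le> 0.000005" by (rule p_star_approx)
  show "\<exists>\<sigma>. k_myopic M g {1, 3} 2 \<sigma> \<and> low_rule M g \<sigma>" by (rule low_strategy_exists)
  show "\<exists>\<sigma>. stationary M g {1, 3} \<sigma> \<and> high_rule M g \<sigma>" by (rule high_strategy_exists)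
next
  fix \<sigma> assume "p \<le> p_star" "k_myopic M g {1, 3} 2 \<sigma> \<and> low_rule M g \<sigma>"
  then show "optimal M g {1, 3} \<sigma>" using low_optimal(1)[OF assms] by blast
next
  fix \<sigma> assume "p_star < p \<and> p < 1" "stationary M g {1, 3} \<sigma> \<and> high_rule M g \<sigma>"
  then show "optimal M g {1, 3} \<sigma>" using high_optimal(2)[OF assms] by simp
next
  assume "p_star < p \<and> p < 1" "\<exists>\<sigma>. myopic M g {1, 3} \<sigma> \<and> optimal M g {1, 3} \<sigma>"
  then show False using myopic_not_optimal[OF assms] unfolding myopic_def by blast
next
  assume "p \<le> p_star"
  then show "uniform_value M g {1, 3} (p * (3 - 3 * p + p ^ 2) / (1 + p - p ^ 2))"
    using low_optimal(2)[OF assms] low_strategy_exists[of M g] unfolding low_value_def by blast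
next
  assume "p_star \<le> p"
  then show "uniform_value M g {1, 3}
      (p * (28 - 90 * p + 127 * p ^ 2 - 98 * p ^ 3 + 43 * p ^ 4 - 10 * p ^ 5 + p ^ 6) /
       (12 - 29 * p + 25 * p ^ 2 - 2 * p ^ 3 - 10 * p ^ 4 + 6 * p ^ 5 - p ^ 6))"
    using high_optimal(3)[OF assms] high_strategy_exists[of M g]
    unfolding high_numer_def high_denom_def by blast
qed

end
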